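(* Let $n>d\ge 1$ be integers, let $\bm{A}\in\mathbb{R}^{d\times(n-d)}$, $\bm{\alpha}_0\in\mathbb{R}^{1\times(n-d)}$, $\widetilde{\bm{A}}=\binom{\bm{\alpha}_0}{\bm{A}}$, and $\mathscr{H}=\{(\bm{x},\widetilde{\bm{x}}\cdot\widetilde{\bm{A}}):\bm{x}\in\mathbb{R}^d\}$ with $\widetilde{\bm{x}}=(1,\bm{x})$. Let $s>0$ and let $\psi:\mathbb{N}\to\mathbb{R}_{\ge0}$ be any function (not necessarily monotonic). If $\sum_{q=1}^\infty\psi(q)^{n-d+s}q^{d-s}<\infty$ and $\omega(\bm{A})<\frac{d(n-d+s)}{d+1-s}$, then $\mathcal{H}^s(\mathscr{S}_n(\psi)\cap\mathscr{H})=0$.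
   Context: $\mathcal{H}^s$ is $s$-dimensional Hausdorff measure. For $y\in\mathbb{R}$, $\|y\|$ is the distance to the nearest integer; for vectors $\|\bm{y}\|=\max_k\|y_k\|$ and $|\bm{y}|$ is the supremum norm. $\mathscr{S}_n(\psi)=\{\bm{x}\in\mathbb{R}^n:\|q\bm{x}\|<\psi(q)\text{ for infinitely many }q\in\mathbb{N}\}$. For $\bm{M}\in\mathbb{R}^{l\times m}$ with rows $\mathrm{row}_u(\bm{M})$, $\omega(\bm{M})$ is the supremum of all $\omega$ for which $\prod_{u=1}^l\|\bm{j}\cdot\mathrm{row}_u(\bm{M})\|<|\bm{j}|^{-\omega}$ has infinitely many solutions $\bm{j}\in\mathbb{Z}^m$. *)

theory Defs
  imports "HOL-Analysis.Analysis"
begin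

text \<open>
  Meant for \<open>s > 0\<close>: because \<open>0 powr 0 = 0\<close>, the value at \<open>s = 0\<close> is not the counting measure.
  Boundedness is required explicitly because \<^const>\<open>diameter\<close> of an unbounded set is an
  unspecified real number.
\<close>

definition hausdorff_premeasure :: "real \<Rightarrow> real \<Rightarrow> 'a::metric_space set \<Rightarrow> ennreal" where
  "hausdorff_premeasure s \<delta> E =
     (INF U \<in> {U :: nat \<Rightarrow> 'a set. E \<subseteq> (\<Union>i. U i) \<and> (\<forall>i. bounded (U i) \<and> diameter (U i) \<le> \<delta>)}.
        \<Sum>i. ennreal (diameter (U i) powr s))"

definition hausdorff_measure :: "real \<Rightarrow> 'a::metric_space set \<Rightarrow> ennreal" where
  "hausdorff_measure s E = (SUP \<delta> \<in> {0<..}. hausdorff_premeasure s \<delta> E)"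

definition dist_int :: "real \<Rightarrow> real" where
  "dist_int y = infdist y \<int>"

definition dist_int_vec :: "real ^ 'n \<Rightarrow> real" where
  "dist_int_vec y = Max (range (\<lambda>k. dist_int (y $ k)))"

definition simul_approx :: "(nat \<Rightarrow> real) \<Rightarrow> (real ^ 'n) set" where
  "simul_approx \<psi> = {x. infinite {q. 1 \<le> q \<and> dist_int_vec (real q *\<^sub>R x) < \<psi> q}}"

text \<open>
  Vectors of \<open>\<int>\<^sup>m\<close> are the real vectors with integer entries. The exponent may be infinite.
\<close>

definition mult_exponent :: "real ^ 'm ^ 'l \<Rightarrow> ereal" where
  "mult_exponent M =
     Sup {ereal w | w.
       infinite {j :: real ^ 'm. (\<forall>k. j $ k \<in> \<int>) \<and>
         (\<Prod>u\<in>UNIV. dist_int (j \<bullet> row u M)) < infnorm j powr (- w)}}"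

text \<open>
  The index type \<^typ>\<open>'d option\<close> is \<open>{0, 1, \<dots>, d}\<close>, with \<^term>\<open>None\<close> in the role of \<open>0\<close>, and
  \<^typ>\<open>'d + 'm\<close> is \<open>{1, \<dots>, n}\<close> with the first \<open>d\<close> coordinates in the left summand.
\<close>

definition aug_vec :: "real ^ 'd \<Rightarrow> real ^ ('d option)" where
  "aug_vec x = (\<chi> i. case i of None \<Rightarrow> 1 | Some k \<Rightarrow> x $ k)"

definition aug_matrix :: "real ^ 'm \<Rightarrow> real ^ 'm ^ 'd \<Rightarrow> real ^ 'm ^ ('d option)" where
  "aug_matrix \<alpha>\<^sub>0 A = (\<chi> i. case i of None \<Rightarrow> \<alpha>\<^sub>0 | Some k \<Rightarrow> A $ k)"

definition vec_append :: "real ^ 'd \<Rightarrow> real ^ 'm \<Rightarrow> real ^ ('d + 'm)" where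
  "vec_append x y = (\<chi> i. case i of Inl k \<Rightarrow> x $ k | Inr k \<Rightarrow> y $ k)"

definition affine_graph :: "real ^ 'm \<Rightarrow> real ^ 'm ^ 'd \<Rightarrow> (real ^ ('d + 'm)) set" where
  "affine_graph \<alpha>\<^sub>0 A = {vec_append x (aug_vec x v* aug_matrix \<alpha>\<^sub>0 A) | x. True}"

end

theory Submission
  imports Defs
begin

text \<open>
  If the point \<open>(x, \<alpha>\<^sub>0 + x A)\<close> satisfies the inequality for
  \<open>q\<close>, rounding \<open>q x\<close> gives an integer vector \<open>a\<close> for which
  the affine form \<open>q \<alpha>\<^sub>0 + a A\<close> lies within \<open>O (\<psi> q)\<close> of
  an integer vector, so by a Borel--Cantelli covering it suffices that there are \<open>O
  (\<psi>(q)\<^sup>m q\<^sup>d)\<close> such \<open>a\<close> with \<open>|a| = O (q)\<close>, where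
  \<open>m = n - d\<close>. Exponential sums of length \<open>J \<approx> 1 / \<psi>(q)\<close>
  bound this number by \<open>J\<close> to the power \<open>-m\<close> times
  \<open>q\<^sup>d\<close> plus the sum of \<open>1 / \<Prod>\<^sub>u \<parallel>j \<cdot>
  row\<^sub>u A\<parallel>\<close> over \<open>0 < |j| < J\<close>. The lower bound on these
  products provided by the exponent applies to differences of two such \<open>j\<close> as well,
  hence separates the points \<open>(j \<cdot> row\<^sub>u A)\<^sub>u\<close>, and the sum is at
  most \<open>J\<close> to the power \<open>\<omega> + o(1)\<close>, which is \<open>O
  (q\<^sup>d)\<close>. For \<open>s > d\<close> the whole affine subspace is a null set.
\<close>

subsection \<open>Hausdorff null sets\<close>

lemma hausdorff_premeasure_le_cover:
  assumes "E \<subseteq> (\<Union>i. U i)" "\<And>i. bounded (U i)" "\<And>i. diameter (U i) \<le> \<delta>"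
  shows "hausdorff_premeasure s \<delta> E \<le> (\<Sum>i. ennreal (diameter (U i) powr s))"
  unfolding hausdorff_premeasure_def by (rule INF_lower) (use assms in auto)

lemma hausdorff_premeasure_less_cover:
  assumes "hausdorff_premeasure s \<delta> E < c"
  obtains U where "E \<subseteq> (\<Union>i::nat. U i)" "\<And>i. bounded (U i)" "\<And>i. diameter (U i) \<le> \<delta>"
    "(\<Sum>i. ennreal (diameter (U i) powr s)) < c"
  using assms unfolding hausdorff_premeasure_def INF_less_iff by blast

lemma hausdorff_premeasure_mono:
  "E \<subseteq> F \<Longrightarrow> hausdorff_premeasure s \<delta> E \<le> hausdorff_premeasure s \<delta> F"
  unfolding hausdorff_premeasure_def by (rule INF_superset_mono) auto

lemma hausdorff_premeasure_bounded_le: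
  assumes "bounded U" "diameter U \<le> \<delta>" "0 \<le> \<delta>"
  shows "hausdorff_premeasure s \<delta> U \<le> ennreal (diameter U powr s)"
proof -
  define V where "V i = (if i = (0::nat) then U else {})" for i
  have "hausdorff_premeasure s \<delta> U \<le> (\<Sum>i. ennreal (diameter (V i) powr s))"
    using assms by (intro hausdorff_premeasure_le_cover) (auto simp: V_def)
  \<comment> \<open>All sets after the first are empty. Their diameter is 0, and
    \<open>0 powr s = 0\<close> for every \<open>s\<close>, so padding the sequence costs
    nothing.\<close>
  also have "\<dots> = (\<Sum>i\<in>{0}. ennreal (diameter (V i) powr s))"
    by (rule suminf_finite) (auto simp: V_def)
  finally show ?thesis by (simp add: V_def)
qed

lemma hausdorff_premeasure_empty: "0 \<le> \<delta> \<Longrightarrow> hausdorff_premeasure s \<delta> {} = 0"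
  using hausdorff_premeasure_bounded_le[of "{}" \<delta> s] by simp

text \<open>Countable subadditivity: each \<open>E i\<close> gets a cover within
  \<open>e * (1/2) ^ Suc i\<close> of its infimum, and the pairing of naturals enumerates all these
  covering sets; the errors add up to \<open>e\<close>. If the right-hand side is infinite there is
  nothing to prove.\<close>

lemma hausdorff_premeasure_UN_le:
  "hausdorff_premeasure s \<delta> (\<Union>i::nat. E i) \<le> (\<Sum>i. hausdorff_premeasure s \<delta> (E i))"
proof (cases "(\<Sum>i. hausdorff_premeasure s \<delta> (E i)) = top")
  case False
  have fin: "hausdorff_premeasure s \<delta> (E i) < top" for i
    using False ennreal_suminf_lessD[of "\<lambda>i. hausdorff_premeasure s \<delta> (E i)" top i]
    by (simp add: top.not_eq_extremum)
  show ?thesis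
  proof (rule ennreal_le_epsilon)
    fix e :: real assume e: "0 < e"
    \<comment> \<open>Finiteness makes the inequality strict, so some cover stays below the enlarged
      bound.\<close>
    have lt: "hausdorff_premeasure s \<delta> (E i) < hausdorff_premeasure s \<delta> (E i) + ennreal (e * (1/2) ^ Suc i)" for i
      using fin[of i] e by (auto simp: ennreal_add_left_cancel_less[of _ 0, simplified])
    have "\<exists>U. E i \<subseteq> (\<Union>k::nat. U k) \<and> (\<forall>k. bounded (U k) \<and> diameter (U k) \<le> \<delta>) \<and>
       (\<Sum>k. ennreal (diameter (U k) powr s))
         \<le> hausdorff_premeasure s \<delta> (E i) + ennreal (e * (1/2) ^ Suc i)" for i
      by (rule hausdorff_premeasure_less_cover[OF lt[of i]]) (blast intro: less_imp_le)
    then obtain U where U: "\<And>i. E i \<subseteq> (\<Union>k::nat. U i k)" "\<And>i k. bounded (U i k)"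
        "\<And>i k. diameter (U i k) \<le> \<delta>"
        "\<And>i. (\<Sum>k. ennreal (diameter (U i k) powr s))
         \<le> hausdorff_premeasure s \<delta> (E i) + ennreal (e * (1/2) ^ Suc i)"
      by metis
    define V where "V n = (case prod_decode n of (i, k) \<Rightarrow> U i k)" for n
    have "(\<Union>i. E i) \<subseteq> (\<Union>n. V n)"
    proof
      fix x assume "x \<in> (\<Union>i. E i)"
      then obtain i k where "x \<in> U i k" using U(1) by blast
      then have "x \<in> V (prod_encode (i, k))" by (simp add: V_def)
      then show "x \<in> (\<Union>n. V n)" by blast
    qed
    then have "hausdorff_premeasure s \<delta> (\<Union>i. E i) \<le> (\<Sum>n. ennreal (diameter (V n) powr s))"
      by (rule hausdorff_premeasure_le_cover) (auto simp: V_def U split: prod.split)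
    also have "\<dots> = (\<Sum>n. (\<lambda>(i, k). ennreal (diameter (U i k) powr s)) (prod_decode n))"
      by (simp add: V_def split_def)
    also have "\<dots> = (\<Sum>i. \<Sum>k. ennreal (diameter (U i k) powr s))"
      by (rule suminf_ennreal_2dimen) simp
    also have "\<dots> \<le> (\<Sum>i. hausdorff_premeasure s \<delta> (E i) + ennreal (e * (1/2) ^ Suc i))"
      by (intro suminf_le U) auto
    also have "\<dots> = (\<Sum>i. hausdorff_premeasure s \<delta> (E i)) + (\<Sum>i. ennreal (e * (1/2) ^ Suc i))"
      by (rule suminf_add[symmetric]) auto
    also have "(\<Sum>i. ennreal (e * (1/2) ^ Suc i)) = ennreal e"
      using sums_mult[OF power_half_series, of e] e by (intro suminf_ennreal_eq) auto
    finally show "hausdorff_premeasure s \<delta> (\<Union>i. E i) \<le> (\<Sum>i. hausdorff_premeasure s \<delta> (E i)) + ennreal e" .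
  qed
qed simp

lemma hausdorff_premeasure_Un_le:
  assumes "0 \<le> \<delta>"
  shows "hausdorff_premeasure s \<delta> (E \<union> F) \<le> hausdorff_premeasure s \<delta> E + hausdorff_premeasure s \<delta> F"
proof -
  define G where "G i = (if i = (0::nat) then E else if i = 1 then F else {})" for i
  have "E \<union> F = (\<Union>i. G i)" by (auto simp: G_def split: if_splits)
  then have "hausdorff_premeasure s \<delta> (E \<union> F) \<le> (\<Sum>i. hausdorff_premeasure s \<delta> (G i))"
    using hausdorff_premeasure_UN_le by metis
  also have "\<dots> = (\<Sum>i\<in>{0,1}. hausdorff_premeasure s \<delta> (G i))"
    by (rule suminf_finite) (auto simp: G_def hausdorff_premeasure_empty assms)
  finally show ?thesis by (simp add: G_def)
qed

lemma hausdorff_premeasure_finite_UN_le: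
  assumes "finite I" "0 \<le> \<delta>"
  shows "hausdorff_premeasure s \<delta> (\<Union>i\<in>I. E i) \<le> (\<Sum>i\<in>I. hausdorff_premeasure s \<delta> (E i))"
  using assms(1)
proof induction
  case (insert i I)
  then show ?case
    using hausdorff_premeasure_Un_le[OF assms(2), of s "E i" "\<Union>i\<in>I. E i"]
    by simp (meson add_left_mono order_trans)
qed (simp add: hausdorff_premeasure_empty assms)

lemma hausdorff_measure_eq_0I:
  "(\<And>\<delta>. 0 < \<delta> \<Longrightarrow> hausdorff_premeasure s \<delta> E = 0) \<Longrightarrow> hausdorff_measure s E = 0"
  unfolding hausdorff_measure_def by (metis SUP_least greaterThan_iff le_zero_eq order_refl)

lemma hausdorff_premeasure_eq_0:
  assumes "hausdorff_measure s E = 0" "0 < \<delta>"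
  shows "hausdorff_premeasure s \<delta> E = 0"
proof -
  have "hausdorff_premeasure s \<delta> E \<le> hausdorff_measure s E"
    unfolding hausdorff_measure_def by (rule SUP_upper) (use assms in auto)
  then show ?thesis using assms by simp
qed

lemma hausdorff_measure_UN_eq_0:
  assumes "\<And>i::nat. hausdorff_measure s (E i) = 0"
  shows "hausdorff_measure s (\<Union>i. E i) = 0"
proof (rule hausdorff_measure_eq_0I)
  fix \<delta> :: real assume "0 < \<delta>"
  then show "hausdorff_premeasure s \<delta> (\<Union>i. E i) = 0"
    using hausdorff_premeasure_UN_le[of s \<delta> E] hausdorff_premeasure_eq_0[OF assms] by simp
qed

lemma hausdorff_measure_mono:
  "E \<subseteq> F \<Longrightarrow> hausdorff_measure s E \<le> hausdorff_measure s F"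
  unfolding hausdorff_measure_def by (intro SUP_mono') (rule hausdorff_premeasure_mono)

text \<open>Every tail of the sets \<open>F q\<close> covers \<open>E\<close>, at a cost bounded by
  a tail of a convergent series. The bound \<open>c\<close> must not depend on
  \<open>\<delta>\<close>, but the index from which it holds may.\<close>

lemma hausdorff_cantelli:
  fixes E :: "'a::metric_space set" and c :: "nat \<Rightarrow> real"
  assumes io: "\<And>x. x \<in> E \<Longrightarrow> infinite {q. x \<in> F q}"
    and c0: "\<And>q. 0 \<le> c q" and c: "summable c"
    and F: "\<And>\<delta>. 0 < \<delta> \<Longrightarrow> \<forall>\<^sub>F q in sequentially. hausdorff_premeasure s \<delta> (F q) \<le> ennreal (c q)"
  shows "hausdorff_measure s E = 0"
proof (rule hausdorff_measure_eq_0I)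
  fix \<delta> :: real assume d: "0 < \<delta>"
  obtain k where k: "\<And>q. k \<le> q \<Longrightarrow> hausdorff_premeasure s \<delta> (F q) \<le> ennreal (c q)"
    using F[OF d] unfolding eventually_sequentially by auto
  have le: "hausdorff_premeasure s \<delta> E \<le> ennreal (\<Sum>q. c (q + N))" if N: "k \<le> N" for N
  proof -
    have "E \<subseteq> (\<Union>q. F (q + N))"
    proof
      fix x assume "x \<in> E"
      then obtain q where "N \<le> q" "x \<in> F q"
        using io[of x] unfolding infinite_nat_iff_unbounded_le by auto
      then show "x \<in> (\<Union>q. F (q + N))" by (auto intro!: exI[of _ "q - N"])
    qed
    then have "hausdorff_premeasure s \<delta> E \<le> hausdorff_premeasure s \<delta> (\<Union>q. F (q + N))"
      by (rule hausdorff_premeasure_mono)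
    also have "\<dots> \<le> (\<Sum>q. hausdorff_premeasure s \<delta> (F (q + N)))"
      by (rule hausdorff_premeasure_UN_le)
    also have "\<dots> \<le> (\<Sum>q. ennreal (c (q + N)))"
      using N by (intro suminf_le k) auto
    also have "\<dots> = ennreal (\<Sum>q. c (q + N))"
      using c0 c by (intro suminf_ennreal2) (auto simp: summable_iff_shift)
    finally show ?thesis .
  qed
  have "(\<lambda>N. ennreal (\<Sum>q. c (q + N))) \<longlonglongrightarrow> ennreal 0"
    by (intro tendsto_ennrealI suminf_exist_split2 c)
  then have "hausdorff_premeasure s \<delta> E \<le> ennreal 0"
    by (rule tendsto_lowerbound) (use le in \<open>auto simp: eventually_sequentially\<close>)
  then show "hausdorff_premeasure s \<delta> E = 0" by simp
qed

subsection \<open>Counting by exponential sums\<close>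

lemma dist_int_eq_round: "dist_int y = \<bar>y - of_int (round y)\<bar>"
proof (rule antisym)
  show "dist_int y \<le> \<bar>y - of_int (round y)\<bar>"
    unfolding dist_int_def using infdist_le[of "of_int (round y)" \<int> y] by (simp add: dist_real_def)
  have "\<exists>k\<in>\<int>. infdist y \<int> = dist y k"
    using infdist_attains_inf[OF closed_Ints, of y] by (metis Ints_0 empty_iff)
  then obtain k :: int where "infdist y \<int> = \<bar>y - of_int k\<bar>"
    by (auto simp: dist_real_def elim!: Ints_cases)
  then show "\<bar>y - of_int (round y)\<bar> \<le> dist_int y"
    unfolding dist_int_def using round_diff_minimal[of y k] by simp
qed

lemma dist_int_nonneg: "0 \<le> dist_int y"
  by (simp add: dist_int_eq_round)

lemma dist_int_le: "dist_int y \<le> \<bar>y - of_int k\<bar>"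
  unfolding dist_int_eq_round by (rule round_diff_minimal)

lemma dist_int_le_half: "dist_int y \<le> 1 / 2"
  unfolding dist_int_eq_round using of_int_round_abs_le[of y] by (simp add: abs_minus_commute)

text \<open>A crude form of Jordan's inequality. Up to \<open>pi / 3\<close> the derivative is at
  least 1/2; beyond, \<open>sin x\<close> is at least \<open>sqrt 3 / 2\<close>, which exceeds
  \<open>pi / 4\<close>.\<close>

lemma sin_ge_half_self:
  fixes x :: real
  assumes "0 \<le> x" "x \<le> pi / 2"
  shows "x / 2 \<le> sin x"
proof (cases "x \<le> pi / 3")
  case True
  show ?thesis
  proof (cases "x = 0")
    case False
    then have "0 < x" using assms by simp
    then obtain z where z: "0 < z" "z < x" "sin x - sin 0 = (x - 0) * cos z"
      using MVT2[of 0 x sin cos] by (auto intro: derivative_eq_intros)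
    have "cos (pi / 3) \<le> cos z"
      using z True pi_gt_zero by (intro cos_monotone_0_pi_le) auto
    then have "x * (1/2) \<le> x * cos z" using \<open>0 < x\<close> by (intro mult_left_mono) (auto simp: cos_60)
    then show ?thesis using z by simp
  qed simp
next
  case False
  have "sin (pi / 3) \<le> sin x"
    using False assms pi_gt_zero by (intro sin_monotone_2pi_le) auto
  moreover have "17 / 10 \<le> sqrt 3" by (rule real_le_rsqrt) (simp add: power2_eq_square)
  moreover have "pi \<le> 34 / 10" using pi_approx by simp
  ultimately show ?thesis using assms by (simp add: sin_60)
qed

section \<open>Additive characters of period 1 and their geometric sums\<close>

definition unit_char :: "real \<Rightarrow> complex" where
  "unit_char t = cis (2 * pi * t)"

lemma norm_unit_char [simp]: "norm (unit_char t) = 1"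
  by (simp add: unit_char_def)

lemma unit_char_0 [simp]: "unit_char 0 = 1"
  by (simp add: unit_char_def)

lemma unit_char_add: "unit_char (a + b) = unit_char a * unit_char b"
  by (simp add: unit_char_def cis_mult distrib_left)

lemma unit_char_diff: "unit_char (a - b) = unit_char a * cnj (unit_char b)"
  by (simp add: unit_char_def cis_mult cis_cnj right_diff_distrib)

lemma unit_char_of_int [simp]: "unit_char (of_int k) = 1"
  unfolding unit_char_def by (metis Ints_of_int cis_multiple_2pi)

lemma unit_char_sum: "finite I \<Longrightarrow> unit_char (\<Sum>i\<in>I. f i) = (\<Prod>i\<in>I. unit_char (f i))"
  by (induction rule: finite_induct) (simp_all add: unit_char_add)

lemma unit_char_cong_int:
  assumes "a - b \<in> \<int>" shows "unit_char a = unit_char b"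
proof -
  obtain k where "a - b = of_int k" using assms by (rule Ints_cases)
  then have "a = of_int k + b" by simp
  then show ?thesis by (metis unit_char_add unit_char_of_int mult_1)
qed

text \<open>With \<open>r\<close> the signed distance from \<open>t\<close> to its rounding, the
  half-angle formula gives the modulus \<open>2 * sin (pi * \<bar>r\<bar>)\<close>, which is at
  least \<open>pi * \<bar>r\<bar>\<close> and hence at least
  \<open>2 * \<bar>r\<bar>\<close>.\<close>

lemma norm_unit_char_minus_1_ge: "2 * dist_int t \<le> norm (unit_char t - 1)"
proof -
  define r where "r = t - of_int (round t)"
  have r: "\<bar>r\<bar> \<le> 1 / 2" and d: "dist_int t = \<bar>r\<bar>"
    using dist_int_le_half[of t] by (auto simp: dist_int_eq_round r_def)
  have "unit_char t = unit_char r"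
    by (rule unit_char_cong_int) (simp add: r_def)
  then have "norm (unit_char t - 1) = sqrt ((cos (2 * pi * r) - 1)\<^sup>2 + (sin (2 * pi * r))\<^sup>2)"
    by (simp add: unit_char_def cmod_def)
  also have "(cos (2 * pi * r) - 1)\<^sup>2 + (sin (2 * pi * r))\<^sup>2 = (2 * sin (pi * r))\<^sup>2"
  proof -
    have "(cos (2 * pi * r) - 1)\<^sup>2 + (sin (2 * pi * r))\<^sup>2 = 2 - 2 * cos (2 * (pi * r))"
      using sin_cos_squared_add[of "2 * pi * r"] by (simp add: power2_diff mult.assoc)
    also have "\<dots> = (2 * sin (pi * r))\<^sup>2"
      by (simp only: cos_double_sin) (simp add: power_mult_distrib)
    finally show ?thesis .
  qed
  finally have "norm (unit_char t - 1) = 2 * \<bar>sin (pi * r)\<bar>" by (simp only: real_sqrt_abs abs_mult abs_numeral)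
  moreover have "\<bar>sin (pi * r)\<bar> = sin (pi * \<bar>r\<bar>)"
  proof -
    have "0 \<le> sin (pi * \<bar>r\<bar>)" using r by (intro sin_ge_zero) (auto simp: mult_left_le)
    then show ?thesis by (cases "0 \<le> r") (auto simp: abs_if)
  qed
  moreover have "(pi * \<bar>r\<bar>) / 2 \<le> sin (pi * \<bar>r\<bar>)"
    using r by (intro sin_ge_half_self) auto
  moreover have "2 * \<bar>r\<bar> \<le> pi * \<bar>r\<bar>" using pi_ge_two by (intro mult_right_mono) auto
  ultimately show ?thesis using d by linarith
qed

text \<open>Multiplication by \<open>unit_char t - 1\<close> telescopes the sum to a difference of
  two numbers of modulus 1. The bound does not depend on the length of the sum.\<close>

lemma norm_geometric_sum_le:
  fixes M :: nat
  assumes "0 < dist_int t"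
  shows "norm (\<Sum>a\<in>{- int M..int M}. unit_char (of_int a * t)) \<le> 1 / dist_int t"
proof -
  define S where "S = (\<Sum>a\<in>{- int M..int M}. unit_char (of_int a * t))"
  have "(unit_char t - 1) * S = (\<Sum>a\<in>{- int M..int M}. unit_char (of_int (a + 1) * t) - unit_char (of_int a * t))"
    unfolding S_def sum_distrib_left
    by (rule sum.cong) (simp_all add: algebra_simps unit_char_add)
  also have "\<dots> = (\<Sum>k<2 * M + 1. unit_char (of_int (int (Suc k) - int M) * t) - unit_char (of_int (int k - int M) * t))"
    by (rule sum.reindex_bij_witness[of _ "\<lambda>k. int k - int M" "\<lambda>a. nat (a + int M)"])
       (auto simp: algebra_simps)
  also have "\<dots> = unit_char (of_int (int (2 * M + 1) - int M) * t) - unit_char (of_int (- int M) * t)"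
    by (subst sum_lessThan_telescope) simp
  finally have "norm ((unit_char t - 1) * S) \<le> 1 + 1"
    by (metis norm_triangle_ineq4 norm_unit_char)
  then have "2 * dist_int t * norm S \<le> 2"
    using norm_unit_char_minus_1_ge[of t]
    by (smt (verit) norm_mult mult_right_mono norm_ge_zero)
  then show ?thesis
    unfolding S_def using assms by (simp add: field_simps)
qed

text \<open>
  A large-sieve style count: the exponential sum over the cube \<open>[0, J)\<^sup>m\<close> has modulus at least
  \<open>J\<^sup>m / 2\<close> at every point counted on the left; square it, sum over all of \<open>B\<close> and open the square.
\<close>

lemma card_near_integer_le:
  fixes B :: "'a set" and y :: "'a \<Rightarrow> 'm::finite \<Rightarrow> real" and J :: nat
  assumes B: "finite B" and J: "1 \<le> J"
  shows "real (card {a \<in> B. \<forall>v. (real J - 1) * dist_int (y a v) \<le> 1 / (6 * real CARD('m))}) * real J ^ CARD('m)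
    \<le> 4 * (\<Sum>j\<in>(\<Pi>\<^sub>E v\<in>UNIV. {- int J<..<int J}).
             norm (\<Sum>a\<in>B. unit_char (\<Sum>v\<in>UNIV. of_int (j v) * y a v)))"
proof -
  define G where "G = {a \<in> B. \<forall>v. (real J - 1) * dist_int (y a v) \<le> 1 / (6 * real CARD('m))}"
  define K :: "('m \<Rightarrow> int) set" where "K = (\<Pi>\<^sub>E v\<in>UNIV. {0..<int J})"
  \<comment> \<open>The box of differences: for fixed \<open>l\<close> in \<open>K\<close> the
    vectors \<open>k - l\<close> run injectively through part of \<open>D\<close>, so the double sum
    over \<open>K\<close> costs \<open>card K\<close> times one sum over \<open>D\<close>.\<close>
  define D :: "('m \<Rightarrow> int) set" where "D = (\<Pi>\<^sub>E v\<in>UNIV. {- int J<..<int J})"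
  define e where "e j a = unit_char (\<Sum>v\<in>UNIV. of_int (j v) * y a v)" for j :: "'m \<Rightarrow> int" and a
  define f where "f j = norm (\<Sum>a\<in>B. e j a)" for j
  have finK: "finite K" and finD: "finite D" unfolding K_def D_def by (auto intro!: finite_PiE)
  have cardK: "real (card K) = real J ^ CARD('m)" by (simp add: K_def card_PiE)
  have large: "real (card K) / 2 \<le> norm (\<Sum>k\<in>K. e k a)" if a: "a \<in> G" for a
  proof -
    \<comment> \<open>Entries of \<open>k\<close> are at most \<open>J - 1\<close>, so each of the
      \<open>CARD('m)\<close> terms moves the phase by at most \<open>1 / (6 * CARD('m))\<close>
      modulo 1. The phase is within 1/6 of an integer, and
      \<open>cos (pi / 3) = 1/2\<close>.\<close>
    have "1 / 2 \<le> Re (e k a)" if k: "k \<in> K" for k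
    proof -
      define r where "r v = y a v - of_int (round (y a v))" for v
      have k': "0 \<le> k v" "k v \<le> int J - 1" for v
        using k by (auto simp: K_def PiE_def Pi_def)
      have "e k a = unit_char (\<Sum>v\<in>UNIV. of_int (k v) * r v)"
        unfolding e_def by (rule unit_char_cong_int)
          (auto simp: r_def sum_subtractf[symmetric] algebra_simps intro!: Ints_sum)
      moreover have "\<bar>\<Sum>v\<in>UNIV. of_int (k v) * r v\<bar> \<le> (\<Sum>v\<in>(UNIV :: 'm set). 1 / (6 * real CARD('m)))"
      proof (rule order_trans[OF sum_abs sum_mono])
        fix v
        have "\<bar>of_int (k v) * r v\<bar> = of_int (k v) * dist_int (y a v)"
          using k'[of v] by (simp add: abs_mult dist_int_eq_round r_def)
        also have "\<dots> \<le> (real J - 1) * dist_int (y a v)"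
          using k'[of v] by (intro mult_right_mono dist_int_nonneg) linarith
        also have "\<dots> \<le> 1 / (6 * real CARD('m))" using a by (simp add: G_def)
        finally show "\<bar>of_int (k v) * r v\<bar> \<le> 1 / (6 * real CARD('m))" .
      qed
      then have "\<bar>\<Sum>v\<in>UNIV. of_int (k v) * r v\<bar> \<le> 1 / 6" by simp
      then have "cos (pi / 3) \<le> cos \<bar>2 * pi * (\<Sum>v\<in>UNIV. of_int (k v) * r v)\<bar>"
        by (intro cos_monotone_0_pi_le) (auto simp: abs_mult)
      ultimately show ?thesis by (simp add: unit_char_def cos_60)
    qed
    then have "(\<Sum>k\<in>K. 1 / 2) \<le> (\<Sum>k\<in>K. Re (e k a))" by (intro sum_mono) auto
    also have "\<dots> \<le> norm (\<Sum>k\<in>K. e k a)" by (metis Re_sum complex_Re_le_cmod)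
    finally show ?thesis by simp
  qed
  have "real (card G) * (real (card K) / 2)\<^sup>2 = (\<Sum>a\<in>G. (real (card K) / 2)\<^sup>2)" by simp
  also have "\<dots> \<le> (\<Sum>a\<in>G. (norm (\<Sum>k\<in>K. e k a))\<^sup>2)"
    by (intro sum_mono power_mono large) auto
  \<comment> \<open>Squares are nonnegative, so the sum may be extended to all of \<open>B\<close>;
    this removes the condition defining \<open>G\<close> from the range of \<open>a\<close>.\<close>
  also have "\<dots> \<le> (\<Sum>a\<in>B. (norm (\<Sum>k\<in>K. e k a))\<^sup>2)"
    by (rule sum_mono2[OF B]) (auto simp: G_def)
  also have "\<dots> = Re (\<Sum>a\<in>B. (\<Sum>k\<in>K. e k a) * cnj (\<Sum>k\<in>K. e k a))"
    unfolding cmod_power2 by (simp add: power2_eq_square sum_negf)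
  also have "(\<Sum>a\<in>B. (\<Sum>k\<in>K. e k a) * cnj (\<Sum>k\<in>K. e k a)) = (\<Sum>a\<in>B. \<Sum>l\<in>K. \<Sum>k\<in>K. e (\<lambda>v. k v - l v) a)"
  proof (rule sum.cong[OF refl])
    fix a
    have *: "e (\<lambda>v. k v - l v) a = e k a * cnj (e l a)" for k l
      unfolding e_def by (simp add: left_diff_distrib sum_subtractf unit_char_diff)
    show "(\<Sum>k\<in>K. e k a) * cnj (\<Sum>k\<in>K. e k a) = (\<Sum>l\<in>K. \<Sum>k\<in>K. e (\<lambda>v. k v - l v) a)"
      unfolding * cnj_sum sum_product by (rule sum.swap)
  qed
  also have "\<dots> = (\<Sum>l\<in>K. \<Sum>k\<in>K. \<Sum>a\<in>B. e (\<lambda>v. k v - l v) a)"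
    by (subst sum.swap, rule sum.cong[OF refl], rule sum.swap)
  also have "Re \<dots> \<le> (\<Sum>l\<in>K. \<Sum>k\<in>K. f (\<lambda>v. k v - l v))"
    unfolding Re_sum f_def by (intro sum_mono complex_Re_le_cmod[THEN order_trans[rotated]]) simp
  also have "\<dots> \<le> (\<Sum>l\<in>K. \<Sum>j\<in>D. f j)"
  proof (rule sum_mono)
    fix l assume l: "l \<in> K"
    have "(\<Sum>k\<in>K. f (\<lambda>v. k v - l v)) = sum f ((\<lambda>k v. k v - l v) ` K)"
      by (subst sum.reindex) (auto simp: inj_on_def fun_eq_iff)
    also have "\<dots> \<le> sum f D"
    proof (rule sum_mono2[OF finD])
      show "(\<lambda>k v. k v - l v) ` K \<subseteq> D"
      proof safe
        fix k assume k: "k \<in> K"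
        have "- int J < k v - l v \<and> k v - l v < int J" for v
        proof -
          have "k v \<in> {0..<int J}" "l v \<in> {0..<int J}" using k l by (auto simp: K_def)
          then show ?thesis by auto
        qed
        then show "(\<lambda>v. k v - l v) \<in> D" by (auto simp: D_def)
      qed
    qed (simp add: f_def)
    finally show "(\<Sum>k\<in>K. f (\<lambda>v. k v - l v)) \<le> sum f D" .
  qed
  finally have "real (card G) * (real (card K) / 2)\<^sup>2 \<le> real (card K) * sum f D" by simp
  then have "real (card K) * (real (card G) * real (card K)) \<le> real (card K) * (4 * sum f D)"
    by (simp add: power2_eq_square field_simps)
  moreover have "0 < real (card K)" using J by (simp add: cardK)
  ultimately have "real (card G) * real (card K) \<le> 4 * sum f D" by simp
  then show ?thesis unfolding cardK by (simp add: G_def f_def D_def e_def)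
qed

text \<open>The character turns the sum over coordinates into a product, so the sum over a box
  factors into one-dimensional sums; the shift \<open>c\<close> only contributes a factor of modulus
  1.\<close>

lemma norm_exponential_sum_box:
  fixes \<theta> :: "'d::finite \<Rightarrow> real" and S :: "int set"
  assumes "finite S"
  shows "norm (\<Sum>a\<in>(\<Pi>\<^sub>E u\<in>UNIV. S). unit_char (c + (\<Sum>u\<in>UNIV. of_int (a u) * \<theta> u)))
    = (\<Prod>u\<in>UNIV. norm (\<Sum>x\<in>S. unit_char (of_int x * \<theta> u)))"
proof -
  have "(\<Sum>a\<in>(\<Pi>\<^sub>E u\<in>UNIV. S). unit_char (c + (\<Sum>u\<in>UNIV. of_int (a u) * \<theta> u)))
      = unit_char c * (\<Sum>a\<in>(\<Pi>\<^sub>E u\<in>UNIV. S). \<Prod>u\<in>UNIV. unit_char (of_int (a u) * \<theta> u))"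
    by (simp add: unit_char_add unit_char_sum sum_distrib_left)
  also have "\<dots> = unit_char c * (\<Prod>u\<in>UNIV. \<Sum>x\<in>S. unit_char (of_int x * \<theta> u))"
    using assms by (subst prod_sum_PiE) auto
  finally show ?thesis by (simp add: norm_mult prod_norm)
qed

subsection \<open>Product-separated points\<close>

text \<open>Pigeonhole in one coordinate \<open>w\<close>, which may be any: two points in the same
  cell of length \<open>h\<close> would have a product of differences below \<open>h\<close> times
  the remaining side lengths, and \<open>h\<close> is chosen to make this equal to
  \<open>v\<close>.\<close>

lemma card_product_separated_le:
  fixes g :: "'i \<Rightarrow> 'd::finite \<Rightarrow> real" and a l :: "'d \<Rightarrow> real"
  assumes T: "finite T" and v: "0 < v" and l: "\<And>u. 0 < l u"
    and box: "\<And>i u. i \<in> T \<Longrightarrow> a u \<le> g i u \<and> g i u \<le> a u + l u"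
    and sep: "\<And>i j. i \<in> T \<Longrightarrow> j \<in> T \<Longrightarrow> i \<noteq> j \<Longrightarrow> v \<le> (\<Prod>u\<in>UNIV. \<bar>g i u - g j u\<bar>)"
  shows "real (card T) \<le> (\<Prod>u\<in>UNIV. l u) / v + 2"
proof -
  define P where "P = (\<Prod>u\<in>UNIV. l u)"
  fix w :: 'd
  define h where "h = v * l w / P"
  have P: "0 < P" unfolding P_def by (rule prod_pos) (use l in auto)
  have h: "0 < h" using P v l by (simp add: h_def)
  have "inj_on (\<lambda>i. \<lfloor>g i w / h\<rfloor>) T"
  proof (rule inj_onI, rule ccontr)
    fix i j assume ij: "i \<in> T" "j \<in> T" "\<lfloor>g i w / h\<rfloor> = \<lfloor>g j w / h\<rfloor>" "i \<noteq> j"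
    have "\<bar>g i w / h - g j w / h\<bar> < 1" using ij(3) by linarith
    then have "\<bar>g i w - g j w\<bar> < h"
      using h by (simp add: diff_divide_distrib[symmetric] abs_divide)
    moreover have "(\<Prod>u\<in>UNIV. \<bar>g i u - g j u\<bar>) = \<bar>g i w - g j w\<bar> * (\<Prod>u\<in>UNIV - {w}. \<bar>g i u - g j u\<bar>)"
      by (rule prod.remove) auto
    moreover have "\<dots> \<le> \<bar>g i w - g j w\<bar> * (\<Prod>u\<in>UNIV - {w}. l u)"
    proof (intro mult_left_mono prod_mono conjI)
      fix u show "\<bar>g i u - g j u\<bar> \<le> l u"
        using box[OF ij(1), of u] box[OF ij(2), of u] by linarith
    qed auto
    moreover have Q: "0 < (\<Prod>u\<in>UNIV - {w}. l u)" by (rule prod_pos) (use l in auto)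
    ultimately have "(\<Prod>u\<in>UNIV. \<bar>g i u - g j u\<bar>) < h * (\<Prod>u\<in>UNIV - {w}. l u)"
      by (smt (verit) mult_strict_right_mono)
    also have "P = l w * (\<Prod>u\<in>UNIV - {w}. l u)" unfolding P_def by (rule prod.remove) auto
    then have "h * (\<Prod>u\<in>UNIV - {w}. l u) = v"
      using less_imp_neq[OF Q] less_imp_neq[OF l[of w]] unfolding h_def by (metis mult.assoc nonzero_mult_div_cancel_right mult_eq_0_iff times_divide_eq_left)
    finally show False using sep[OF ij(1,2,4)] by simp
  qed
  then have "card T = card ((\<lambda>i. \<lfloor>g i w / h\<rfloor>) ` T)" by (simp add: card_image)
  also have "\<dots> \<le> card {\<lfloor>a w / h\<rfloor>..\<lfloor>(a w + l w) / h\<rfloor>}"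
    using box h by (intro card_mono) (auto intro!: floor_mono divide_right_mono)
  also have "\<dots> = nat (\<lfloor>(a w + l w) / h\<rfloor> + 1 - \<lfloor>a w / h\<rfloor>)" by simp
  \<comment> \<open>The range of floors includes both ends, and rounding its lower end down costs
    less than 1 more; hence the summand 2.\<close>
  also have "real \<dots> \<le> (a w + l w) / h - a w / h + 2"
  proof -
    have "\<lfloor>a w / h\<rfloor> \<le> \<lfloor>(a w + l w) / h\<rfloor>"
      using h l[of w] by (intro floor_mono divide_right_mono) auto
    then show ?thesis by linarith
  qed
  also have "\<dots> = P / v + 2"
    using l[of w] v P unfolding h_def by (simp add: field_simps)
  finally show ?thesis by (simp add: P_def)
qed

text \<open>
  Sort the points by sign and dyadic size of each coordinate. A class contained in a box of volume
  \<open>P\<close> has \<open>O (P / v)\<close> members by separation and each contributes at most \<open>1 / P\<close>, so all classes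
  contribute \<open>O (1 / v)\<close> and only their number, a power of a logarithm, is lost.
\<close>

lemma sum_inverse_product_separated_le:
  fixes g :: "'i \<Rightarrow> 'd::finite \<Rightarrow> real"
  assumes S: "finite S" and v: "0 < v" "v \<le> 1"
    and le1: "\<And>j u. j \<in> S \<Longrightarrow> \<bar>g j u\<bar> \<le> 1"
    and low: "\<And>j. j \<in> S \<Longrightarrow> v \<le> (\<Prod>u\<in>UNIV. \<bar>g j u\<bar>)"
    and sep: "\<And>i j. i \<in> S \<Longrightarrow> j \<in> S \<Longrightarrow> i \<noteq> j \<Longrightarrow> v \<le> (\<Prod>u\<in>UNIV. \<bar>g i u - g j u\<bar>)"
  shows "(\<Sum>j\<in>S. \<Prod>u\<in>UNIV. 1 / \<bar>g j u\<bar>)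
    \<le> (2 * (2 - log 2 v)) ^ CARD('d) * ((1 + 2 * 2 ^ CARD('d)) / v)"
proof -
  define \<kappa> where "\<kappa> j u = (0 < g j u, \<lfloor>log 2 \<bar>g j u\<bar>\<rfloor>)" for j u
  have g0: "g j u \<noteq> 0" if "j \<in> S" for j u
  proof
    assume "g j u = 0"
    then have "(\<Prod>u\<in>UNIV. \<bar>g j u\<bar>) = 0" by (intro prod_zero) auto
    then show False using low[OF that] v(1) by linarith
  qed
  \<comment> \<open>The other factors are at most 1, so each coordinate alone is at least
    \<open>v\<close> in size. This bounds the dyadic exponents from below.\<close>
  have ge: "v \<le> \<bar>g j u\<bar>" if "j \<in> S" for j u
  proof -
    have "(\<Prod>u\<in>UNIV. \<bar>g j u\<bar>) = \<bar>g j u\<bar> * (\<Prod>u\<in>UNIV - {u}. \<bar>g j u\<bar>)"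
      by (rule prod.remove) auto
    also have "\<dots> \<le> \<bar>g j u\<bar> * 1"
      using le1[OF that] by (intro mult_left_mono prod_le_1) auto
    finally show ?thesis using low[OF that] by simp
  qed
  have fiber: "(\<Sum>j\<in>{j \<in> S. \<kappa> j = c}. \<Prod>u\<in>UNIV. 1 / \<bar>g j u\<bar>) \<le> (1 + 2 * 2 ^ CARD('d)) / v"
    if c: "c \<in> \<kappa> ` S" for c
  proof -
    define T where "T = {j \<in> S. \<kappa> j = c}"
    define l where "l u = (2::real) powr of_int (snd (c u))" for u
    \<comment> \<open>Lower end of the dyadic interval from \<open>l u\<close> to
      \<open>2 * l u\<close> or of its mirror image; both have length \<open>l u\<close>.\<close>
    define a where "a u = (if fst (c u) then l u else - (2 * l u))" for u
    define P where "P = (\<Prod>u\<in>UNIV. l u)"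
    have l: "0 < l u" for u by (simp add: l_def)
    have P: "0 < P" unfolding P_def by (rule prod_pos) (use l in auto)
    have dy: "l u \<le> \<bar>g j u\<bar> \<and> \<bar>g j u\<bar> \<le> 2 * l u" if j: "j \<in> T" for j u
    proof -
      have "c u = \<kappa> j u" "j \<in> S" using j by (auto simp: T_def)
      then have s: "snd (c u) = \<lfloor>log 2 \<bar>g j u\<bar>\<rfloor>" and pos: "0 < \<bar>g j u\<bar>"
        using g0 by (auto simp: \<kappa>_def)
      have "l u \<le> 2 powr (log 2 \<bar>g j u\<bar>)" unfolding l_def s by (intro powr_mono) auto
      moreover have "2 powr (log 2 \<bar>g j u\<bar>) \<le> 2 powr (1 + of_int \<lfloor>log 2 \<bar>g j u\<bar>\<rfloor>)"
        by (intro powr_mono) linarith+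
      ultimately show ?thesis using pos by (simp add: l_def s powr_add)
    qed
    have box: "a u \<le> g j u \<and> g j u \<le> a u + l u" if j: "j \<in> T" for j u
    proof -
      have "fst (c u) = (0 < g j u)" using j by (auto simp: T_def \<kappa>_def)
      then show ?thesis using dy[OF j, of u] g0[of j u] j by (auto simp: a_def T_def)
    qed
    have "real (card T) \<le> P / v + 2"
      unfolding P_def
    proof (rule card_product_separated_le[where g = g and a = a])
      show "v \<le> (\<Prod>u\<in>UNIV. \<bar>g i u - g j u\<bar>)" if "i \<in> T" "j \<in> T" "i \<noteq> j" for i j
        using that by (intro sep) (auto simp: T_def)
    qed (use S v l box in \<open>auto simp: T_def\<close>)
    \<comment> \<open>A class in the image of \<open>\<kappa>\<close> has a member, and its product
      lies between \<open>v\<close> and \<open>2 ^ CARD('d) * P\<close>. Thus \<open>P / v\<close>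
      is bounded below and absorbs the additive 2 of the count.\<close>
    moreover have "v \<le> 2 ^ CARD('d) * P"
    proof -
      obtain j where "j \<in> T" using c by (auto simp: T_def)
      then have "v \<le> (\<Prod>u\<in>UNIV. \<bar>g j u\<bar>)" using low by (simp add: T_def)
      also have "\<dots> \<le> (\<Prod>u\<in>UNIV. 2 * l u)" using dy[OF \<open>j \<in> T\<close>] by (intro prod_mono) auto
      finally show ?thesis by (simp add: prod.distrib P_def)
    qed
    ultimately have cardT: "real (card T) \<le> (1 + 2 * 2 ^ CARD('d)) * (P / v)"
      using v by (simp add: field_simps)
    have "(\<Sum>j\<in>T. \<Prod>u\<in>UNIV. 1 / \<bar>g j u\<bar>) \<le> (\<Sum>j\<in>T. \<Prod>u\<in>UNIV. 1 / l u)"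
      using dy l by (intro sum_mono prod_mono) (auto intro!: frac_le)
    also have "\<dots> = real (card T) * (1 / P)" by (simp add: P_def prod_dividef)
    also have "\<dots> \<le> (1 + 2 * 2 ^ CARD('d)) * (P / v) * (1 / P)"
      using P cardT by (intro mult_right_mono) auto
    also have "\<dots> = (1 + 2 * 2 ^ CARD('d)) / v" using P by simp
    finally show ?thesis by (simp add: T_def)
  qed
  define C :: "('d \<Rightarrow> bool \<times> int) set" where "C = (\<Pi>\<^sub>E u\<in>UNIV. UNIV \<times> {\<lfloor>log 2 v\<rfloor>..0})"
  have lv: "log 2 v \<le> 0" using v by simp
  have sub: "\<kappa> ` S \<subseteq> C"
  proof safe
    fix j assume j: "j \<in> S"
    have "\<lfloor>log 2 v\<rfloor> \<le> \<lfloor>log 2 \<bar>g j u\<bar>\<rfloor> \<and> \<lfloor>log 2 \<bar>g j u\<bar>\<rfloor> \<le> 0" for u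
    proof -
      have "log 2 \<bar>g j u\<bar> \<le> 0" using le1[OF j, of u] g0[OF j, of u] by simp
      moreover have "log 2 v \<le> log 2 \<bar>g j u\<bar>" using ge[OF j, of u] v by simp
      ultimately show ?thesis by (simp add: floor_mono)
    qed
    then show "\<kappa> j \<in> C" by (auto simp: C_def \<kappa>_def)
  qed
  have finC: "finite C" unfolding C_def by (auto intro!: finite_PiE)
  have "real (card C) = real (2 * nat (1 - \<lfloor>log 2 v\<rfloor>)) ^ CARD('d)"
    by (simp add: C_def card_PiE card_cartesian_product)
  also have "\<dots> \<le> (2 * (2 - log 2 v)) ^ CARD('d)"
  proof (rule power_mono)
    have "real (nat (1 - \<lfloor>log 2 v\<rfloor>)) \<le> 2 - log 2 v" using lv by linarith
    then show "real (2 * nat (1 - \<lfloor>log 2 v\<rfloor>)) \<le> 2 * (2 - log 2 v)" by simp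
  qed simp
  finally have cC: "real (card (\<kappa> ` S)) \<le> (2 * (2 - log 2 v)) ^ CARD('d)"
    using card_mono[OF finC sub] by linarith
  have "(\<Sum>j\<in>S. \<Prod>u\<in>UNIV. 1 / \<bar>g j u\<bar>)
      = (\<Sum>c\<in>\<kappa> ` S. \<Sum>j\<in>{j \<in> S. \<kappa> j = c}. \<Prod>u\<in>UNIV. 1 / \<bar>g j u\<bar>)"
    by (rule sum.image_gen[OF S])
  also have "\<dots> \<le> (\<Sum>c\<in>\<kappa> ` S. (1 + 2 * 2 ^ CARD('d)) / v)"
    by (rule sum_mono[OF fiber])
  also have "\<dots> = real (card (\<kappa> ` S)) * ((1 + 2 * 2 ^ CARD('d)) / v)" by simp
  also have "\<dots> \<le> (2 * (2 - log 2 v)) ^ CARD('d) * ((1 + 2 * 2 ^ CARD('d)) / v)"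
    using v cC by (intro mult_right_mono) auto
  finally show ?thesis .
qed

text \<open>The bound \<open>ln x \<le> x powr a / a\<close> at \<open>x = 1 / v\<close>, with
  \<open>a = \<epsilon> / d\<close> so that the \<open>d\<close>-th power has exponent
  \<open>\<epsilon>\<close>.\<close>

lemma log_power_le_powr:
  fixes \<epsilon> :: real and d :: nat
  assumes "0 < \<epsilon>" "0 < d"
  obtains K where "0 \<le> K" "\<And>v. 0 < v \<Longrightarrow> v \<le> 1 \<Longrightarrow> (2 * (2 - log 2 v)) ^ d \<le> K * v powr (- \<epsilon>)"
proof
  define a where "a = \<epsilon> / real d"
  have a: "0 < a" using assms by (simp add: a_def)
  define K where "K = 2 * (2 + 1 / (a * ln 2))"
  have K: "0 \<le> K" using a by (simp add: K_def)
  then show "0 \<le> K ^ d" by simp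
  fix v :: real assume v: "0 < v" "v \<le> 1"
  have pow1: "1 \<le> v powr (- a)" using v a powr_mono2'[of "-a" v 1] by simp
  have "ln (1 / v) \<le> (1 / v) powr a / a" using v a by (intro ln_powr_bound) auto
  also have "(1 / v) powr a = v powr (- a)" using v by (simp add: powr_divide powr_minus_divide)
  finally have "- log 2 v \<le> v powr (- a) / a / ln 2"
    unfolding log_def minus_divide_left using v by (intro divide_right_mono) (auto simp: ln_div)
  then have "2 * (2 - log 2 v) \<le> 2 * (2 * v powr (- a) + v powr (- a) / a / ln 2)"
    using pow1 by (intro mult_left_mono) auto
  also have "\<dots> = K * v powr (- a)" by (simp add: K_def field_simps)
  finally have le: "2 * (2 - log 2 v) \<le> K * v powr (- a)" .
  have "log 2 v \<le> 0" using v by simp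
  then have "(2 * (2 - log 2 v)) ^ d \<le> (K * v powr (- a)) ^ d" using le by (intro power_mono) auto
  also have "\<dots> = K ^ d * v powr (- \<epsilon>)"
    using v assms by (simp add: power_mult_distrib powr_power a_def)
  finally show "(2 * (2 - log 2 v)) ^ d \<le> K ^ d * v powr (- \<epsilon>)" .
qed

subsection \<open>The multiplicative exponent\<close>

lemma dist_int_eq_0_iff: "dist_int y = 0 \<longleftrightarrow> y \<in> \<int>"
  by (auto simp: dist_int_eq_round elim!: Ints_cases) (metis Ints_of_int)

text \<open>For \<open>w\<close> above the exponent only finitely many integer vectors violate the
  bound with constant 1, and a smaller constant repairs these, provided no nonzero vector has
  product 0. Such a vector would have infinitely many multiples that violate the bound as
  well.\<close>

lemma mult_exponent_less_imp_lower_bound: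
  fixes A :: "real ^ 'm ^ 'd"
  assumes w: "mult_exponent A < ereal w"
  obtains c where "0 < c"
    "\<And>x. (\<forall>k. x $ k \<in> \<int>) \<Longrightarrow> x \<noteq> 0 \<Longrightarrow> c * infnorm x powr (- w) \<le> (\<Prod>u\<in>UNIV. dist_int (x \<bullet> row u A))"
proof -
  define p where "p x = (\<Prod>u\<in>UNIV. dist_int (x \<bullet> row u A))" for x
  define bad where "bad = {x :: real ^ 'm. (\<forall>k. x $ k \<in> \<int>) \<and> p x < infnorm x powr (- w)}"
  have fin: "finite bad"
  proof (rule ccontr)
    assume "infinite bad"
    then have "ereal w \<le> mult_exponent A"
      unfolding mult_exponent_def bad_def p_def by (intro Sup_upper) blast
    then show False using w by simp
  qed
  have p0: "0 \<le> p x" for x unfolding p_def by (intro prod_nonneg) (auto simp: dist_int_nonneg)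
  have pos: "0 < p x" if x: "\<forall>k. x $ k \<in> \<int>" "x \<noteq> 0" for x
  proof (rule ccontr)
    assume "\<not> 0 < p x"
    then have "p x = 0" using p0[of x] by linarith
    then obtain u where u: "x \<bullet> row u A \<in> \<int>" by (auto simp: p_def dist_int_eq_0_iff)
    have "real (Suc n) *\<^sub>R x \<in> bad" for n
    proof -
      have "(real (Suc n) *\<^sub>R x) \<bullet> row u A \<in> \<int>"
        unfolding inner_scaleR_left using u Ints_of_nat by (intro Ints_mult) blast+
      then have "p (real (Suc n) *\<^sub>R x) = 0"
        unfolding p_def by (intro prod_zero) (auto simp: dist_int_eq_0_iff)
      moreover have "(real (Suc n) *\<^sub>R x) $ k \<in> \<int>" for k
        unfolding vector_scaleR_component real_scaleR_def using x Ints_of_nat by (intro Ints_mult) blast+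
      moreover have "infnorm (real (Suc n) *\<^sub>R x) \<noteq> 0" using x by (simp add: infnorm_eq_0)
      ultimately show ?thesis by (auto simp: bad_def)
    qed
    then have "range (\<lambda>n. real (Suc n) *\<^sub>R x) \<subseteq> bad" by blast
    then have "finite (range (\<lambda>n. real (Suc n) *\<^sub>R x))" using fin finite_subset by blast
    moreover have "inj (\<lambda>n. real (Suc n) *\<^sub>R x)" using x by (auto simp: inj_def)
    ultimately show False using finite_imageD infinite_UNIV_nat by blast
  qed
  \<comment> \<open>The element 1 makes \<open>Q\<close> nonempty and caps \<open>c\<close> at 1,
    which takes care of the vectors outside \<open>bad\<close>.\<close>
  define Q where "Q = insert 1 ((\<lambda>x. p x / infnorm x powr (- w)) ` bad)"
  define c where "c = Min Q"
  \<comment> \<open>The zero vector is not in \<open>bad\<close>, because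
    \<open>0 powr (- w) = 0\<close> and the product is nonnegative.\<close>
  have nz: "x \<noteq> 0" if "x \<in> bad" for x
    using that p0[of x] by (auto simp: bad_def infnorm_0)
  have Q: "finite Q" "Q \<noteq> {}" using fin by (auto simp: Q_def)
  have "0 < c" unfolding c_def Min_gr_iff[OF Q]
  proof
    fix z assume "z \<in> Q"
    then consider "z = 1" | x where "x \<in> bad" "z = p x / infnorm x powr (- w)" by (auto simp: Q_def)
    then show "0 < z"
    proof cases
      case 2
      then have "0 < p x" "0 < infnorm x" using pos[of x] nz[of x] by (auto simp: bad_def infnorm_pos_lt)
      then show ?thesis using 2 by simp
    qed simp
  qed
  moreover have "c * infnorm x powr (- w) \<le> p x" if x: "\<forall>k. x $ k \<in> \<int>" "x \<noteq> 0" for x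
  proof (cases "x \<in> bad")
    case True
    then have "c \<le> p x / infnorm x powr (- w)"
      unfolding c_def using Q by (intro Min_le) (auto simp: Q_def)
    moreover have "0 < infnorm x powr (- w)" using x by (simp add: infnorm_eq_0)
    ultimately show ?thesis by (simp add: pos_le_divide_eq)
  next
    case False
    then have "infnorm x powr (- w) \<le> p x" using x by (auto simp: bad_def)
    moreover have "c \<le> 1" unfolding c_def using Q by (intro Min_le) (auto simp: Q_def)
    then have "c * infnorm x powr (- w) \<le> 1 * infnorm x powr (- w)" by (intro mult_right_mono) auto
    ultimately show ?thesis by simp
  qed
  ultimately show ?thesis using that by (auto simp: p_def)
qed

text \<open>The dot product of an integer vector with row \<open>u\<close>. Coding the vector as a
  function into \<open>int\<close> makes boxes finite function spaces, over which products of sums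
  expand.\<close>

definition int_form :: "real ^ 'm ^ 'd \<Rightarrow> ('m \<Rightarrow> int) \<Rightarrow> 'd \<Rightarrow> real" where
  "int_form A j u = (\<Sum>v\<in>UNIV. of_int (j v) * A $ u $ v)"

lemma int_form_diff: "int_form A (\<lambda>v. i v - j v) u = int_form A i u - int_form A j u"
  by (simp add: int_form_def left_diff_distrib sum_subtractf)

text \<open>As \<open>w\<close> is nonnegative, the norm may be replaced by any bound
  \<open>J\<close> on the entries. The constant is capped at 1 so that the separation
  \<open>v\<close> built from it is at most 1.\<close>

lemma prod_dist_int_form_ge:
  fixes A :: "real ^ 'm ^ 'd"
  assumes "mult_exponent A < ereal w" "0 \<le> w"
  obtains c where "0 < c" "c \<le> 1"
    "\<And>j J. j \<noteq> (\<lambda>_. 0) \<Longrightarrow> (\<And>v. \<bar>of_int (j v)\<bar> \<le> J) \<Longrightarrow>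
      c * J powr (- w) \<le> (\<Prod>u\<in>UNIV. dist_int (int_form A j u))"
proof -
  obtain c where c: "0 < c"
    "\<And>x. (\<forall>k. x $ k \<in> \<int>) \<Longrightarrow> x \<noteq> 0 \<Longrightarrow> c * infnorm x powr (- w) \<le> (\<Prod>u\<in>UNIV. dist_int (x \<bullet> row u A))"
    using mult_exponent_less_imp_lower_bound[OF assms(1)] by blast
  show ?thesis
  proof (rule that[of "min c 1"])
    fix j :: "'m \<Rightarrow> int" and J :: real
    assume j: "j \<noteq> (\<lambda>_. 0)" and J: "\<And>v. \<bar>of_int (j v)\<bar> \<le> J"
    define x :: "real ^ 'm" where "x = (\<chi> v. of_int (j v))"
    have x: "x \<noteq> 0" using j by (auto simp: x_def vec_eq_iff)
    have form: "x \<bullet> row u A = int_form A j u" for u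
      by (simp add: x_def inner_vec_def row_def int_form_def)
    have "infnorm x \<le> J"
      unfolding infnorm_cart using J by (intro cSup_least) (auto simp: x_def)
    then have "J powr (- w) \<le> infnorm x powr (- w)"
      using x assms(2) by (intro powr_mono2') (auto simp: infnorm_pos_lt)
    then have "min c 1 * J powr (- w) \<le> c * infnorm x powr (- w)"
      using c(1) by (intro mult_mono) auto
    also have "\<dots> \<le> (\<Prod>u\<in>UNIV. dist_int (x \<bullet> row u A))"
      using x by (intro c) (auto simp: x_def)
    finally show "min c 1 * J powr (- w) \<le> (\<Prod>u\<in>UNIV. dist_int (int_form A j u))"
      by (simp add: form)
  qed (use c in auto)
qed

text \<open>Differences of vectors in the box have entries of size at most \<open>2 * J\<close>, so
  the lower bound on products separates the signed fractional parts by
  \<open>v = c * (2 * J) powr (- w)\<close>. The sum is then of order \<open>1 / v\<close> up to a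
  power of a logarithm, which \<open>\<epsilon>\<close> absorbs.\<close>

lemma sum_inverse_forms_le:
  fixes A :: "real ^ 'm ^ 'd"
  assumes w: "mult_exponent A < ereal w" "0 \<le> w" and \<epsilon>: "0 < \<epsilon>"
  obtains K where "0 \<le> K"
    "\<And>J :: nat. 1 \<le> J \<Longrightarrow>
      (\<Sum>j\<in>(\<Pi>\<^sub>E v\<in>UNIV. {- int J<..<int J}) - {\<lambda>_. 0}. \<Prod>u\<in>UNIV. 1 / dist_int (int_form A j u))
        \<le> K * real J powr (w * (1 + \<epsilon>))"
    "\<And>j u. j \<noteq> (\<lambda>_. 0) \<Longrightarrow> 0 < dist_int (int_form A j u)"
proof -
  obtain c where c: "0 < c" "c \<le> 1"
    "\<And>j J. j \<noteq> (\<lambda>_. 0) \<Longrightarrow> (\<And>v. \<bar>of_int (j v)\<bar> \<le> J) \<Longrightarrow>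
      c * J powr (- w) \<le> (\<Prod>u\<in>UNIV. dist_int (int_form A j u))"
    using prod_dist_int_form_ge[OF w] by blast
  obtain L where L: "0 \<le> L"
    "\<And>v. 0 < v \<Longrightarrow> v \<le> 1 \<Longrightarrow> (2 * (2 - log 2 v)) ^ CARD('d) \<le> L * v powr (- \<epsilon>)"
    using log_power_le_powr[OF \<epsilon>, of "CARD('d)"] by auto
  define C :: real where "C = 1 + 2 * 2 ^ CARD('d)"
  define K where "K = L * C * c powr (- (1 + \<epsilon>)) * 2 powr (w * (1 + \<epsilon>))"
  show ?thesis
  proof (rule that[of K])
    show "0 \<le> K" using L(1) by (simp add: K_def C_def)
  next
    fix j :: "'m \<Rightarrow> int" and u assume j: "j \<noteq> (\<lambda>_. 0)"
    define J where "J = real_of_int (\<Sum>v\<in>UNIV. \<bar>j v\<bar>)"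
    have le: "\<bar>real_of_int (j v)\<bar> \<le> J" for v
    proof -
      have "\<bar>j v\<bar> \<le> (\<Sum>v\<in>UNIV. \<bar>j v\<bar>)" by (rule member_le_sum) auto
      then show ?thesis unfolding J_def by linarith
    qed
    obtain v where "j v \<noteq> 0" using j by auto
    then have "0 < J" using le[of v] by linarith
    then have "0 < c * J powr (- w)" using c by simp
    also have "\<dots> \<le> (\<Prod>u\<in>UNIV. dist_int (int_form A j u))" by (rule c(3)[OF j le])
    finally have "dist_int (int_form A j u) \<noteq> 0" by (metis UNIV_I finite less_irrefl prod_zero)
    then show "0 < dist_int (int_form A j u)" using dist_int_nonneg[of "int_form A j u"] by linarith
  next
    fix J :: nat assume J: "1 \<le> J"
    define S where "S = (\<Pi>\<^sub>E v\<in>(UNIV :: 'm set). {- int J<..<int J}) - {\<lambda>_. 0}"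
    define g where "g j u = int_form A j u - of_int (round (int_form A j u))" for j u
    define v where "v = c * (2 * real J) powr (- w)"
    have g: "\<bar>g j u\<bar> = dist_int (int_form A j u)" for j u
      by (simp add: g_def dist_int_eq_round)
    have v: "0 < v" "v \<le> 1"
    proof -
      have "(2 * real J) powr (- w) \<le> 1" using J w(2) by (simp add: powr_minus field_simps ge_one_powr_ge_zero)
      then show "0 < v" "v \<le> 1" using c J unfolding v_def by (auto intro: mult_le_one)
    qed
    have S: "finite S" unfolding S_def by (auto intro!: finite_PiE)
    have "(\<Sum>j\<in>S. \<Prod>u\<in>UNIV. 1 / \<bar>g j u\<bar>) \<le> (2 * (2 - log 2 v)) ^ CARD('d) * ((1 + 2 * 2 ^ CARD('d)) / v)"
    proof (rule sum_inverse_product_separated_le[OF S v])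
      show "\<bar>g j u\<bar> \<le> 1" for j u
        unfolding g using dist_int_le_half[of "int_form A j u"] by linarith
      show "v \<le> (\<Prod>u\<in>UNIV. \<bar>g j u\<bar>)" if "j \<in> S" for j
        unfolding g v_def
      proof (rule c(3))
        fix v
        have "j v \<in> {- int J<..<int J}" using that by (auto simp: S_def)
        then show "\<bar>real_of_int (j v)\<bar> \<le> 2 * real J" by auto
      qed (use that in \<open>auto simp: S_def\<close>)
      show "v \<le> (\<Prod>u\<in>UNIV. \<bar>g i u - g j u\<bar>)" if ij: "i \<in> S" "j \<in> S" "i \<noteq> j" for i j
      proof -
        have "v \<le> (\<Prod>u\<in>UNIV. dist_int (int_form A (\<lambda>v. i v - j v) u))"
          unfolding v_def
        proof (rule c(3))
          show "(\<lambda>v. i v - j v) \<noteq> (\<lambda>_. 0)" using ij by (auto simp: fun_eq_iff)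
          fix v
          have "i v \<in> {- int J<..<int J}" "j v \<in> {- int J<..<int J}" using ij by (auto simp: S_def)
          then show "\<bar>real_of_int (i v - j v)\<bar> \<le> 2 * real J" by auto
        qed
        \<comment> \<open>The difference of two fractional parts differs by an integer from the form
          at \<open>i - j\<close>.\<close>
        also have "\<dots> \<le> (\<Prod>u\<in>UNIV. \<bar>g i u - g j u\<bar>)"
        proof (intro prod_mono conjI dist_int_nonneg)
          fix u
          have "g i u - g j u = int_form A (\<lambda>v. i v - j v) u
            - of_int (round (int_form A i u) - round (int_form A j u))"
            by (simp add: g_def int_form_diff)
          then show "dist_int (int_form A (\<lambda>v. i v - j v) u) \<le> \<bar>g i u - g j u\<bar>"
            using dist_int_le by metis
        qed
        finally show ?thesis .
      qed
    qed
    also have "\<dots> \<le> L * v powr (- \<epsilon>) * (C / v)"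
      unfolding C_def using L(2)[OF v] v by (intro mult_right_mono) auto
    also have "\<dots> = L * C * v powr (- (1 + \<epsilon>))"
      using v by (simp add: powr_diff powr_minus field_simps powr_add)
    also have "v powr (- (1 + \<epsilon>)) = c powr (- (1 + \<epsilon>)) * 2 powr (w * (1 + \<epsilon>)) * real J powr (w * (1 + \<epsilon>))"
      using c J unfolding v_def by (simp add: powr_mult powr_powr algebra_simps)
    finally show "(\<Sum>j\<in>S. \<Prod>u\<in>UNIV. 1 / dist_int (int_form A j u)) \<le> K * real J powr (w * (1 + \<epsilon>))"
      by (simp add: g K_def mult.assoc)
  qed
qed

text \<open>In the exponential sum count, \<open>j = 0\<close> contributes the number of points of
  the box. For other \<open>j\<close> the sum over the box is a product of geometric sums with
  frequencies \<open>int_form A j u\<close>. The shift \<open>\<alpha>\<close> only affects phases,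
  so the bound is uniform in it.\<close>

lemma card_rational_points_le:
  fixes A :: "real ^ 'm ^ 'd"
  assumes w: "mult_exponent A < ereal w" "0 \<le> w" and \<epsilon>: "0 < \<epsilon>"
  obtains K where "0 \<le> K"
    "\<And>(J :: nat) (M :: nat) \<alpha>. 1 \<le> J \<Longrightarrow>
      real (card {a \<in> (\<Pi>\<^sub>E u\<in>UNIV. {- int M..int M}).
         \<forall>v. (real J - 1) * dist_int (\<alpha> v + (\<Sum>u\<in>UNIV. of_int (a u) * A $ u $ v)) \<le> 1 / (6 * real CARD('m))})
        * real J ^ CARD('m)
      \<le> 4 * ((2 * real M + 1) ^ CARD('d) + K * real J powr (w * (1 + \<epsilon>)))"
proof -
  obtain K where K: "0 \<le> K"
    "\<And>J :: nat. 1 \<le> J \<Longrightarrow>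
      (\<Sum>j\<in>(\<Pi>\<^sub>E v\<in>UNIV. {- int J<..<int J}) - {\<lambda>_. 0}. \<Prod>u\<in>UNIV. 1 / dist_int (int_form A j u))
        \<le> K * real J powr (w * (1 + \<epsilon>))"
    "\<And>j u. j \<noteq> (\<lambda>_. 0) \<Longrightarrow> 0 < dist_int (int_form A j u)"
    using sum_inverse_forms_le[OF w \<epsilon>] by blast
  show ?thesis
  proof (rule that[OF K(1)])
    fix J M :: nat and \<alpha> :: "'m \<Rightarrow> real" assume J: "1 \<le> J"
    define B :: "('d \<Rightarrow> int) set" where "B = (\<Pi>\<^sub>E u\<in>UNIV. {- int M..int M})"
    define D :: "('m \<Rightarrow> int) set" where "D = (\<Pi>\<^sub>E v\<in>UNIV. {- int J<..<int J})"
    define y where "y a v = \<alpha> v + (\<Sum>u\<in>UNIV. of_int (a u) * A $ u $ v)" for a :: "'d \<Rightarrow> int" and v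
    define f where "f j = norm (\<Sum>a\<in>B. unit_char (\<Sum>v\<in>UNIV. of_int (j v) * y a v))" for j :: "'m \<Rightarrow> int"
    have fB: "finite B" and fD: "finite D" unfolding B_def D_def by (auto intro!: finite_PiE)
    have f: "f j = (\<Prod>u\<in>UNIV. norm (\<Sum>x\<in>{- int M..int M}. unit_char (of_int x * int_form A j u)))" for j
    proof -
      \<comment> \<open>Exchanging the sums exhibits the phase as an affine function of
        \<open>a\<close>, with the forms as coefficients.\<close>
      have "(\<Sum>v\<in>UNIV. of_int (j v) * y a v)
          = (\<Sum>v\<in>UNIV. of_int (j v) * \<alpha> v) + (\<Sum>u\<in>UNIV. of_int (a u) * int_form A j u)" for a
      proof -
        have "(\<Sum>v\<in>UNIV. \<Sum>u\<in>UNIV. of_int (j v) * (of_int (a u) * A $ u $ v))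
            = (\<Sum>u\<in>UNIV. \<Sum>v\<in>UNIV. of_int (a u) * (of_int (j v) * A $ u $ v))"
          by (subst sum.swap) (simp add: mult.left_commute)
        then show ?thesis
          by (simp add: y_def int_form_def distrib_left sum.distrib sum_distrib_left)
      qed
      then show ?thesis
        unfolding f_def B_def by (simp add: norm_exponential_sum_box)
    qed
    have f0: "f (\<lambda>_. 0) = (2 * real M + 1) ^ CARD('d)"
    proof -
      have "norm (2 * complex_of_nat M + 1) = 2 * real M + 1"
        using norm_of_nat[of "2 * M + 1", where 'a = complex] by (simp add: add.commute)
      then show ?thesis by (simp add: f int_form_def)
    qed
    have fle: "f j \<le> (\<Prod>u\<in>UNIV. 1 / dist_int (int_form A j u))" if "j \<in> D - {\<lambda>_. 0}" for j
      unfolding f using that by (intro prod_mono conjI norm_geometric_sum_le K(3)) auto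
    have "(\<lambda>_. 0) \<in> D" using J by (auto simp: D_def)
    then have "sum f D = f (\<lambda>_. 0) + sum f (D - {\<lambda>_. 0})" by (rule sum.remove[OF fD])
    also have "\<dots> \<le> (2 * real M + 1) ^ CARD('d) + (\<Sum>j\<in>D - {\<lambda>_. 0}. \<Prod>u\<in>UNIV. 1 / dist_int (int_form A j u))"
      unfolding f0 by (intro add_left_mono sum_mono fle)
    also have "\<dots> \<le> (2 * real M + 1) ^ CARD('d) + K * real J powr (w * (1 + \<epsilon>))"
      unfolding D_def by (intro add_left_mono K(2) J)
    finally have le: "4 * sum f D \<le> 4 * ((2 * real M + 1) ^ CARD('d) + K * real J powr (w * (1 + \<epsilon>)))"
      by simp
    have "real (card {a \<in> B. \<forall>v. (real J - 1) * dist_int (y a v) \<le> 1 / (6 * real CARD('m))})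
        * real J ^ CARD('m) \<le> 4 * sum f D"
      unfolding f_def D_def by (rule card_near_integer_le[OF fB J])
    from order_trans[OF this le]
    show "real (card {a \<in> (\<Pi>\<^sub>E u\<in>UNIV. {- int M..int M}).
         \<forall>v. (real J - 1) * dist_int (\<alpha> v + (\<Sum>u\<in>UNIV. of_int (a u) * A $ u $ v)) \<le> 1 / (6 * real CARD('m))})
        * real J ^ CARD('m)
      \<le> 4 * ((2 * real M + 1) ^ CARD('d) + K * real J powr (w * (1 + \<epsilon>)))"
      unfolding B_def y_def .
  qed
qed

subsection \<open>Covering the affine subspace\<close>

definition graph_point :: "real ^ 'm \<Rightarrow> real ^ 'm ^ 'd \<Rightarrow> real ^ 'd \<Rightarrow> real ^ ('d + 'm)" where
  "graph_point \<alpha> A x = vec_append x (aug_vec x v* aug_matrix \<alpha> A)"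

lemma graph_point_Inl [simp]: "graph_point \<alpha> A x $ Inl u = x $ u"
  by (simp add: graph_point_def vec_append_def)

lemma graph_point_Inr [simp]:
  "graph_point \<alpha> A x $ Inr v = \<alpha> $ v + (\<Sum>u\<in>UNIV. x $ u * A $ u $ v)"
proof -
  have "graph_point \<alpha> A x $ Inr v = (\<Sum>i\<in>UNIV. aug_matrix \<alpha> A $ i $ v * aug_vec x $ i)"
    by (simp add: graph_point_def vec_append_def vector_matrix_mult_def mult.commute)
  also have "\<dots> = \<alpha> $ v + (\<Sum>u\<in>UNIV. x $ u * A $ u $ v)"
    by (simp add: UNIV_option_conv sum.reindex aug_matrix_def aug_vec_def mult.commute)
  finally show ?thesis .
qed

text \<open>A Lipschitz constant, in the supremum norm, for the parametrization: the sum controls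
  the linear part, and the 1 covers the coordinates of \<open>x\<close> themselves.\<close>

definition graph_const :: "real ^ 'm ^ 'd \<Rightarrow> real" where
  "graph_const A = 1 + (\<Sum>v\<in>UNIV. \<Sum>u\<in>UNIV. \<bar>A $ u $ v\<bar>)"

lemma graph_const_ge_1: "1 \<le> graph_const A"
  by (simp add: graph_const_def sum_nonneg)

lemma abs_linear_combination_le:
  fixes A :: "real ^ 'm ^ 'd"
  assumes "\<And>u. \<bar>z u\<bar> \<le> t"
  shows "\<bar>\<Sum>u\<in>UNIV. z u * A $ u $ v\<bar> \<le> (graph_const A - 1) * t"
proof -
  have t: "0 \<le> t" using assms[of undefined] by linarith
  have "\<bar>\<Sum>u\<in>UNIV. z u * A $ u $ v\<bar> \<le> (\<Sum>u\<in>UNIV. \<bar>z u * A $ u $ v\<bar>)" by (rule sum_abs)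
  also have "\<dots> \<le> (\<Sum>u\<in>UNIV. t * \<bar>A $ u $ v\<bar>)"
    unfolding abs_mult by (intro sum_mono mult_right_mono assms) auto
  also have "\<dots> = t * (\<Sum>u\<in>UNIV. \<bar>A $ u $ v\<bar>)" by (simp add: sum_distrib_left)
  also have "\<dots> \<le> t * (\<Sum>v\<in>UNIV. \<Sum>u\<in>UNIV. \<bar>A $ u $ v\<bar>)"
    using t by (intro mult_left_mono member_le_sum[of v]) (auto intro: sum_nonneg)
  finally show ?thesis by (simp add: graph_const_def mult.commute)
qed

lemma dist_graph_point_le:
  fixes A :: "real ^ 'm ^ 'd"
  assumes "\<And>u. \<bar>x $ u - y $ u\<bar> \<le> t"
  shows "dist (graph_point \<alpha> A x) (graph_point \<alpha> A y) \<le> real CARD('d + 'm) * graph_const A * t"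
proof -
  have t: "0 \<le> t" using assms[of undefined] by linarith
  have "\<bar>(graph_point \<alpha> A x - graph_point \<alpha> A y) $ i\<bar> \<le> graph_const A * t" for i
  proof (cases i)
    case (Inl u)
    have "1 * t \<le> graph_const A * t" using t graph_const_ge_1 by (intro mult_right_mono) auto
    then show ?thesis using Inl assms[of u] by simp
  next
    case (Inr v)
    have "(graph_point \<alpha> A x - graph_point \<alpha> A y) $ i = (\<Sum>u\<in>UNIV. (x $ u - y $ u) * A $ u $ v)"
      using Inr by (simp add: left_diff_distrib sum_subtractf)
    then show ?thesis
      using abs_linear_combination_le[of "\<lambda>u. x $ u - y $ u" t A v, OF assms] t
      by (simp add: left_diff_distrib)
  qed
  then have "(\<Sum>i\<in>UNIV. \<bar>(graph_point \<alpha> A x - graph_point \<alpha> A y) $ i\<bar>)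
      \<le> (\<Sum>i\<in>(UNIV :: ('d + 'm) set). graph_const A * t)"
    by (intro sum_mono) auto
  also have "\<dots> = real CARD('d + 'm) * graph_const A * t" by simp
  finally show ?thesis
    unfolding dist_norm using norm_le_l1_cart order_trans by blast
qed

text \<open>The part of the subspace lying over cubes of half-side \<open>r / q\<close> about the
  rational points \<open>a / q\<close>, written without division.\<close>

definition graph_nbhd ::
    "real ^ 'm \<Rightarrow> real ^ 'm ^ 'd \<Rightarrow> nat \<Rightarrow> real \<Rightarrow> ('d \<Rightarrow> int) set \<Rightarrow> (real ^ ('d + 'm)) set" where
  "graph_nbhd \<alpha> A q r G =
     {graph_point \<alpha> A x | x. \<exists>a\<in>G. \<forall>u. \<bar>real q * x $ u - of_int (a u)\<bar> \<le> r}"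

text \<open>One covering set per rational point: its parameters differ by at most
  \<open>2 * r / q\<close> in each coordinate, and \<open>L\<close> contains this 2 and the constant
  of \<open>dist_graph_point_le\<close>.\<close>

lemma hausdorff_premeasure_graph_nbhd_le:
  fixes A :: "real ^ 'm ^ 'd"
  defines "L \<equiv> 2 * real CARD('d + 'm) * graph_const A"
  assumes G: "finite G" and q: "1 \<le> q" and r: "0 \<le> r" and s: "0 \<le> s" and \<delta>: "L * r / real q \<le> \<delta>"
  shows "hausdorff_premeasure s \<delta> (graph_nbhd \<alpha> A q r G) \<le> ennreal (real (card G) * (L * r / real q) powr s)"
proof -
  define U where "U a = {graph_point \<alpha> A x | x. \<forall>u. \<bar>real q * x $ u - of_int (a u)\<bar> \<le> r}" for a :: "'d \<Rightarrow> int"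
  have L: "0 \<le> L" using graph_const_ge_1[of A] by (simp add: L_def)
  have Lr: "0 \<le> L * r / real q" using L r by simp
  have close: "dist z z' \<le> L * r / real q" if zz: "z \<in> U a" "z' \<in> U a" for z z' a
  proof -
    obtain x x' where x: "z = graph_point \<alpha> A x" "\<And>u. \<bar>real q * x $ u - of_int (a u)\<bar> \<le> r"
      and x': "z' = graph_point \<alpha> A x'" "\<And>u. \<bar>real q * x' $ u - of_int (a u)\<bar> \<le> r"
      using zz by (auto simp: U_def)
    have "\<bar>x $ u - x' $ u\<bar> \<le> 2 * r / real q" for u
    proof -
      have "\<bar>real q * x $ u - real q * x' $ u\<bar> \<le> 2 * r" using x(2)[of u] x'(2)[of u] by linarith
      then have "\<bar>real q * (x $ u - x' $ u)\<bar> \<le> 2 * r" by (simp add: right_diff_distrib)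
      then have "real q * \<bar>x $ u - x' $ u\<bar> \<le> 2 * r" by (simp add: abs_mult)
      then show ?thesis using q by (simp add: pos_le_divide_eq mult.commute)
    qed
    then show ?thesis unfolding x x' using dist_graph_point_le[of x x' "2 * r / real q" \<alpha> A]
      by (simp add: L_def mult_ac)
  qed
  have "graph_nbhd \<alpha> A q r G = (\<Union>a\<in>G. U a)" by (auto simp: graph_nbhd_def U_def)
  then have "hausdorff_premeasure s \<delta> (graph_nbhd \<alpha> A q r G) \<le> (\<Sum>a\<in>G. hausdorff_premeasure s \<delta> (U a))"
    using hausdorff_premeasure_finite_UN_le[OF G order_trans[OF Lr \<delta>], of s U] by simp
  also have "\<dots> \<le> (\<Sum>a\<in>G. ennreal ((L * r / real q) powr s))"
  proof (rule sum_mono)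
    fix a
    have bd: "bounded (U a)" unfolding bounded_two_points using close by blast
    have diam: "diameter (U a) \<le> L * r / real q"
      using Lr close by (intro diameter_le) (auto simp: dist_norm)
    have "hausdorff_premeasure s \<delta> (U a) \<le> ennreal (diameter (U a) powr s)"
      using bd diam \<delta> Lr by (intro hausdorff_premeasure_bounded_le) auto
    also have "\<dots> \<le> ennreal ((L * r / real q) powr s)"
      using diam s diameter_ge_0[OF bd] by (intro ennreal_leI powr_mono2)
    finally show "hausdorff_premeasure s \<delta> (U a) \<le> ennreal ((L * r / real q) powr s)" .
  qed
  also have "\<dots> = ennreal (real (card G) * (L * r / real q) powr s)"
    by (simp add: ennreal_mult' ennreal_of_nat_eq_real_of_nat)
  finally show ?thesis .
qed

text \<open>The count is applied with \<open>J\<close> of order \<open>1 / \<rho>\<close>. The lower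
  bound on \<open>\<rho>\<close> keeps \<open>J\<close> below \<open>2 * q powr \<eta>\<close>, so
  by \<open>exps\<close> the error term is of order \<open>q ^ CARD('d)\<close>, like the main term.
  Division by \<open>J ^ CARD('m)\<close> gives the power of \<open>\<rho>\<close>.\<close>

lemma card_near_graph_le:
  fixes A :: "real ^ 'm ^ 'd"
  assumes w: "mult_exponent A < ereal w" "0 \<le> w" and \<epsilon>: "0 < \<epsilon>" and \<eta>: "0 < \<eta>"
    and exps: "\<eta> * (w * (1 + \<epsilon>)) \<le> real CARD('d)" and C: "1 \<le> C"
  obtains K where "0 \<le> K"
    "\<And>(q :: nat) \<rho> \<alpha>. 1 \<le> q \<Longrightarrow> real q powr (- \<eta>) \<le> \<rho> \<Longrightarrow>
      real (card {a \<in> (\<Pi>\<^sub>E u\<in>UNIV. {- int (q * (R + 1))..int (q * (R + 1))}).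
         \<forall>v. dist_int (\<alpha> v + (\<Sum>u\<in>UNIV. of_int (a u) * A $ u $ v)) \<le> C * \<rho>})
      \<le> K * \<rho> ^ CARD('m) * real q ^ CARD('d)"
proof -
  obtain K where K: "0 \<le> K"
    "\<And>(J :: nat) (M :: nat) \<alpha>. 1 \<le> J \<Longrightarrow>
      real (card {a \<in> (\<Pi>\<^sub>E u\<in>UNIV. {- int M..int M}).
         \<forall>v. (real J - 1) * dist_int (\<alpha> v + (\<Sum>u\<in>UNIV. of_int (a u) * A $ u $ v)) \<le> 1 / (6 * real CARD('m))})
        * real J ^ CARD('m)
      \<le> 4 * ((2 * real M + 1) ^ CARD('d) + K * real J powr (w * (1 + \<epsilon>)))"
    using card_rational_points_le[OF w \<epsilon>] by blast
  define m where "m = real CARD('m)"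
  have m: "1 \<le> m" by (simp add: m_def Suc_leI)
  define e where "e = w * (1 + \<epsilon>)"
  have e: "0 \<le> e" using w \<epsilon> by (simp add: e_def)
  define C1 where "C1 = 4 * (real (2 * R + 3) ^ CARD('d) + K * 2 powr e)"
  have C1: "0 \<le> C1" using K(1) by (simp add: C1_def)
  show ?thesis
  proof (rule that[of "C1 * (6 * m * C) ^ CARD('m)"])
    show "0 \<le> C1 * (6 * m * C) ^ CARD('m)" using C1 m C by simp
  next
    fix q :: nat and \<rho> :: real and \<alpha> :: "'m \<Rightarrow> real"
    assume q: "1 \<le> q" and \<rho>: "real q powr (- \<eta>) \<le> \<rho>"
    define M where "M = q * (R + 1)"
    define b where "b = 6 * m * C * \<rho>"
    \<comment> \<open>Rounding up gives both bounds needed: \<open>J - 1 \<le> 1 / b\<close> meets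
      the tolerance of the count, and \<open>1 / b \<le> J\<close> allows dividing by the power of
      \<open>J\<close> at the end.\<close>
    define J where "J = nat \<lceil>1 / b\<rceil>"
    define N where "N = card {a \<in> (\<Pi>\<^sub>E u\<in>UNIV. {- int M..int M}).
         \<forall>v. dist_int (\<alpha> v + (\<Sum>u\<in>UNIV. of_int (a u) * A $ u $ v)) \<le> C * \<rho>}"
    have "0 < real q powr (- \<eta>)" using q by simp
    then have \<rho>0: "0 < \<rho>" using \<rho> by linarith
    have b: "0 < b" using m C \<rho>0 by (simp add: b_def)
    have J1: "1 \<le> J" using b by (simp add: J_def Suc_le_eq)
    have Jge: "1 / b \<le> real J" by (simp add: J_def real_nat_ceiling_ge)
    have Jle: "real J - 1 \<le> 1 / b"
      using b unfolding J_def by (smt (verit) ceiling_correct divide_pos_pos of_nat_nat zero_le_ceiling)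
    have sub: "{a \<in> (\<Pi>\<^sub>E u\<in>UNIV. {- int M..int M}).
         \<forall>v. dist_int (\<alpha> v + (\<Sum>u\<in>UNIV. of_int (a u) * A $ u $ v)) \<le> C * \<rho>}
       \<subseteq> {a \<in> (\<Pi>\<^sub>E u\<in>UNIV. {- int M..int M}).
         \<forall>v. (real J - 1) * dist_int (\<alpha> v + (\<Sum>u\<in>UNIV. of_int (a u) * A $ u $ v)) \<le> 1 / (6 * real CARD('m))}"
    proof (intro Collect_mono impI, elim conjE, intro conjI allI, assumption)
      fix a :: "'d \<Rightarrow> int" and v
      assume "\<forall>v. dist_int (\<alpha> v + (\<Sum>u\<in>UNIV. of_int (a u) * A $ u $ v)) \<le> C * \<rho>"
      then have "(real J - 1) * dist_int (\<alpha> v + (\<Sum>u\<in>UNIV. of_int (a u) * A $ u $ v)) \<le> 1 / b * (C * \<rho>)"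
        using Jle b by (intro mult_mono dist_int_nonneg) auto
      also have "\<dots> = 1 / (6 * real CARD('m))" using C \<rho>0 by (simp add: b_def m_def)
      finally show "(real J - 1) * dist_int (\<alpha> v + (\<Sum>u\<in>UNIV. of_int (a u) * A $ u $ v)) \<le> 1 / (6 * real CARD('m))" .
    qed
    have fin: "finite (\<Pi>\<^sub>E u\<in>(UNIV :: 'd set). {- int M..int M})" by (auto intro!: finite_PiE)
    have "N \<le> card {a \<in> (\<Pi>\<^sub>E u\<in>UNIV. {- int M..int M}).
         \<forall>v. (real J - 1) * dist_int (\<alpha> v + (\<Sum>u\<in>UNIV. of_int (a u) * A $ u $ v)) \<le> 1 / (6 * real CARD('m))}"
      unfolding N_def by (rule card_mono[OF finite_subset[OF _ fin] sub]) auto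
    then have "real N * real J ^ CARD('m) \<le> 4 * ((2 * real M + 1) ^ CARD('d) + K * real J powr e)"
      using K(2)[OF J1, of M \<alpha>] unfolding e_def
      by (smt (verit) mult_right_mono of_nat_le_iff zero_le_power of_nat_0_le_iff)
    also have "\<dots> \<le> C1 * real q ^ CARD('d)"
    proof -
      have "2 * real M + 1 \<le> real (2 * R + 3) * real q"
        using q by (simp add: M_def algebra_simps)
      then have 1: "(2 * real M + 1) ^ CARD('d) \<le> real (2 * R + 3) ^ CARD('d) * real q ^ CARD('d)"
        unfolding power_mult_distrib[symmetric] by (intro power_mono) auto
      have "1 / b \<le> 1 / \<rho>"
      proof (rule divide_left_mono)
        have "1 * \<rho> \<le> 6 * m * C * \<rho>"
          using m C \<rho>0 mult_mono[of 1 m 1 C] by (intro mult_right_mono) auto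
        then show "\<rho> \<le> b" by (simp add: b_def)
      qed (use b \<rho>0 in auto)
      also have "\<dots> \<le> 1 / real q powr (- \<eta>)" using \<rho> \<rho>0 q by (intro divide_left_mono) auto
      finally have "1 / b \<le> real q powr \<eta>" using q by (simp add: powr_minus_divide)
      moreover have "1 \<le> real q powr \<eta>" using q \<eta> by (simp add: ge_one_powr_ge_zero)
      ultimately have "real J \<le> 2 * real q powr \<eta>" using Jle by linarith
      then have "real J powr e \<le> (2 * real q powr \<eta>) powr e" using e by (intro powr_mono2) auto
      also have "\<dots> = 2 powr e * real q powr (\<eta> * e)" by (simp add: powr_mult powr_powr)
      also have "\<dots> \<le> 2 powr e * real q powr (real CARD('d))"
        using q exps by (intro mult_left_mono powr_mono) (auto simp: e_def)
      also have "\<dots> = 2 powr e * real q ^ CARD('d)" using q by (simp add: powr_realpow)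
      finally have "K * real J powr e \<le> K * (2 powr e * real q ^ CARD('d))" using K(1) by (rule mult_left_mono)
      then show ?thesis using 1 unfolding C1_def by (simp add: algebra_simps)
    qed
    finally have le: "real N * real J ^ CARD('m) \<le> C1 * real q ^ CARD('d)" .
    have "real N = real N * ((1 / b) ^ CARD('m) * b ^ CARD('m))"
      using b by (simp flip: power_mult_distrib)
    also have "\<dots> = real N * (1 / b) ^ CARD('m) * b ^ CARD('m)" by simp
    also have "\<dots> \<le> real N * real J ^ CARD('m) * b ^ CARD('m)"
      using Jge b by (intro mult_right_mono mult_left_mono power_mono) auto
    also have "\<dots> \<le> C1 * real q ^ CARD('d) * b ^ CARD('m)"
      using le b by (intro mult_right_mono) auto
    finally have "real N \<le> C1 * (6 * m * C) ^ CARD('m) * \<rho> ^ CARD('m) * real q ^ CARD('d)"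
      by (simp add: b_def power_mult_distrib mult_ac)
    then show "real (card {a \<in> (\<Pi>\<^sub>E u\<in>UNIV. {- int (q * (R + 1))..int (q * (R + 1))}).
         \<forall>v. dist_int (\<alpha> v + (\<Sum>u\<in>UNIV. of_int (a u) * A $ u $ v)) \<le> C * \<rho>})
      \<le> C1 * (6 * m * C) ^ CARD('m) * \<rho> ^ CARD('m) * real q ^ CARD('d)"
      unfolding N_def M_def .
  qed
qed

text \<open>For \<open>q \<ge> 1\<close> the extra \<open>q\<close> in \<open>q * (R + 1)\<close>
  absorbs the rounding error of 1/2.\<close>

lemma round_mem_box:
  assumes "\<bar>x\<bar> \<le> real R"
  shows "round (real q * x) \<in> {- int (q * (R + 1))..int (q * (R + 1))}"
proof (cases "q = 0")
  case False
  have "\<bar>real q * x\<bar> \<le> real q * real R" using assms by (simp add: abs_mult mult_left_mono)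
  moreover have "\<bar>of_int (round (real q * x)) - real q * x\<bar> \<le> 1 / 2" by (rule of_int_round_abs_le)
  ultimately have "\<bar>of_int (round (real q * x))\<bar> < real q * real R + 1" by linarith
  also have "\<dots> \<le> real (q * (R + 1))" using False by (simp add: algebra_simps)
  finally have "real_of_int \<bar>round (real q * x)\<bar> < real_of_int (int (q * (R + 1)))" by simp
  then have "\<bar>round (real q * x)\<bar> < int (q * (R + 1))" by (simp only: of_int_less_iff)
  then show ?thesis by auto
qed simp

text \<open>A grid of mesh \<open>1 / q\<close> covers the bounded piece by \<open>O (q ^ d)\<close>
  sets of diameter \<open>O (1 / q)\<close>, at total cost \<open>O (q powr (d - s))\<close>, which
  tends to 0.\<close>

lemma hausdorff_measure_bounded_graph_eq_0:
  fixes A :: "real ^ 'm ^ 'd"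
  assumes s: "real CARD('d) < s"
  shows "hausdorff_measure s {graph_point \<alpha> A x | x. \<forall>u. \<bar>x $ u\<bar> \<le> real R} = 0"
proof (rule hausdorff_measure_eq_0I)
  fix \<delta> :: real assume \<delta>: "0 < \<delta>"
  define L where "L = 2 * real CARD('d + 'm) * graph_const A"
  define d where "d = CARD('d)"
  have L: "0 < L" using graph_const_ge_1[of A] by (simp add: L_def add_pos_pos)
  define E where "E = {graph_point \<alpha> A x | x. \<forall>u. \<bar>x $ u\<bar> \<le> real R}"
  define C where "C = real (2 * R + 3) ^ d * L powr s"
  have "eventually (\<lambda>q. hausdorff_premeasure s \<delta> E \<le> ennreal (C * real q powr (real d - s))) sequentially"
    using eventually_ge_at_top[of 1] eventually_ge_at_top[of "nat \<lceil>L / \<delta>\<rceil>"]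
  proof eventually_elim
    case (elim q)
    define G :: "('d \<Rightarrow> int) set" where "G = (\<Pi>\<^sub>E u\<in>UNIV. {- int (q * (R + 1))..int (q * (R + 1))})"
    have fG: "finite G" unfolding G_def by (auto intro!: finite_PiE)
    have "L / \<delta> \<le> real q" using elim(2) by linarith
    then have \<delta>': "L * 1 / real q \<le> \<delta>" using \<delta> elim(1) by (simp add: field_simps)
    have "E \<subseteq> graph_nbhd \<alpha> A q 1 G"
    proof
      fix z assume "z \<in> E"
      then obtain x where x: "z = graph_point \<alpha> A x" "\<And>u. \<bar>x $ u\<bar> \<le> real R" by (auto simp: E_def)
      have "(\<lambda>u. round (real q * x $ u)) \<in> G"
        unfolding G_def using round_mem_box[OF x(2), of q] by auto
      moreover have "\<bar>real q * x $ u - of_int (round (real q * x $ u))\<bar> \<le> 1" for u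
        using of_int_round_abs_le[of "real q * x $ u"] by linarith
      ultimately show "z \<in> graph_nbhd \<alpha> A q 1 G"
        unfolding graph_nbhd_def x(1) by (intro CollectI exI[of _ x] conjI refl bexI allI)
    qed
    then have "hausdorff_premeasure s \<delta> E \<le> hausdorff_premeasure s \<delta> (graph_nbhd \<alpha> A q 1 G)"
      by (rule hausdorff_premeasure_mono)
    also have "\<dots> \<le> ennreal (real (card G) * (L * 1 / real q) powr s)"
      unfolding L_def using fG elim(1) s \<delta>'
      by (intro hausdorff_premeasure_graph_nbhd_le) (auto simp: L_def)
    also have "\<dots> \<le> ennreal (C * real q powr (real d - s))"
    proof (rule ennreal_leI)
      have "real (card G) = (2 * real (q * (R + 1)) + 1) ^ d"
        by (simp add: G_def card_PiE d_def algebra_simps)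
      also have "\<dots> \<le> (real (2 * R + 3) * real q) ^ d"
        using elim(1) by (intro power_mono) (auto simp: algebra_simps)
      also have "\<dots> = real (2 * R + 3) ^ d * real q powr real d"
        using elim(1) by (simp add: power_mult_distrib powr_realpow)
      finally have "real (card G) * (L * 1 / real q) powr s
          \<le> real (2 * R + 3) ^ d * real q powr real d * (L * 1 / real q) powr s"
        by (rule mult_right_mono) simp
      also have "\<dots> = C * real q powr (real d - s)"
        using elim(1) L by (simp add: C_def powr_divide powr_diff)
      finally show "real (card G) * (L * 1 / real q) powr s \<le> C * real q powr (real d - s)" .
    qed
    finally show ?case .
  qed
  moreover have "(\<lambda>q. ennreal (C * real q powr (real d - s))) \<longlonglongrightarrow> ennreal (C * 0)"
    using s by (intro tendsto_ennrealI tendsto_mult_left tendsto_neg_powr filterlim_real_sequentially)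
      (simp add: d_def)
  ultimately have "hausdorff_premeasure s \<delta> E \<le> ennreal (C * 0)"
    by (intro tendsto_lowerbound[of _ _ sequentially]) auto
  then show "hausdorff_premeasure s \<delta> {graph_point \<alpha> A x | x. \<forall>u. \<bar>x $ u\<bar> \<le> real R} = 0"
    by (simp add: E_def)
qed

section \<open>The range where \<open>s\<close> is at most the dimension of the subspace\<close>

lemma dist_int_le_add: "dist_int x \<le> dist_int y + \<bar>x - y\<bar>"
  using dist_int_le[of x "round y"] unfolding dist_int_eq_round[of y] by linarith

lemma dist_int_le_dist_int_vec: "dist_int (y $ k) \<le> dist_int_vec y"
  unfolding dist_int_vec_def by (rule Max_ge) auto

text \<open>Convergence needs \<open>\<eta>\<close> above \<open>e\<close>, and the count needs
  \<open>\<eta> * w * (1 + \<epsilon>)\<close> to be at most \<open>d\<close>. The available room is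
  the factor \<open>t > 1\<close>; one square root of it enlarges \<open>\<eta>\<close>, the other
  is \<open>1 + \<epsilon>\<close>.\<close>

lemma exists_exponents:
  fixes w d m s :: real
  assumes "0 < w" "0 < d" "0 < d + 1 - s" "0 < m + s" "w < d * (m + s) / (d + 1 - s)"
  obtains \<eta> \<epsilon> where "0 < \<eta>" "0 < \<epsilon>" "\<eta> * (w * (1 + \<epsilon>)) \<le> d" "d + 1 - s < \<eta> * (m + s)"
proof -
  define e where "e = (d + 1 - s) / (m + s)"
  have e: "0 < e" using assms by (simp add: e_def)
  define t where "t = d / (w * e)"
  have "w * e < d" using assms by (simp add: e_def field_simps)
  then have t: "1 < t" using assms e by (simp add: t_def)
  then have st: "1 < sqrt t" by simp
  show ?thesis
  proof (rule that[of "e * sqrt t" "sqrt t - 1"])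
    have "e * sqrt t * (w * (1 + (sqrt t - 1))) = w * e * (sqrt t * sqrt t)" by simp
    also have "\<dots> = d" using t assms e by (simp add: t_def)
    finally show "e * sqrt t * (w * (1 + (sqrt t - 1))) \<le> d" by simp
    have "d + 1 - s = e * (m + s)" using assms by (simp add: e_def)
    also have "\<dots> < e * (m + s) * sqrt t" using st e assms by simp
    finally show "d + 1 - s < e * sqrt t * (m + s)" by (simp add: mult_ac)
  qed (use e st in auto)
qed

text \<open>
  Raising \<open>\<psi> q\<close> to at least \<open>q powr - \<eta>\<close> costs only a convergent series, by the choice of \<open>\<eta>\<close>, and
  brings every \<open>q\<close> into the range where the point count has the expected order of magnitude.
\<close>

lemma hausdorff_measure_simul_approx_graph_eq_0:
  fixes A :: "real ^ 'm ^ 'd"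
  assumes s: "0 < s" "s \<le> real CARD('d)"
    and \<psi>: "\<And>q. 1 \<le> q \<Longrightarrow> 0 \<le> \<psi> q"
    and sum: "summable (\<lambda>q. \<psi> (Suc q) powr (real CARD('m) + s) * real (Suc q) powr (real CARD('d) - s))"
    and w: "mult_exponent A < ereal (real CARD('d) * (real CARD('m) + s) / (real CARD('d) + 1 - s))"
  shows "hausdorff_measure s {graph_point \<alpha> A x | x. (\<forall>u. \<bar>x $ u\<bar> \<le> real R) \<and> graph_point \<alpha> A x \<in> simul_approx \<psi>} = 0"
proof -
  define d where "d = CARD('d)"
  define m where "m = CARD('m)"
  have dm: "0 < d" "0 < m" by (auto simp: d_def m_def)
  define L where "L = 2 * real CARD('d + 'm) * graph_const A"
  have L: "0 < L" using graph_const_ge_1[of A] by (simp add: L_def add_pos_pos)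
  \<comment> \<open>The counting lemmas need a nonnegative \<open>w'\<close>, so it is taken above
    the maximum of 0 and the exponent; this leaves room since the bound is positive.\<close>
  have "0 < ereal (real d * (real m + s) / (real d + 1 - s))" using s dm by (simp add: d_def)
  with w have "max 0 (mult_exponent A) < ereal (real d * (real m + s) / (real d + 1 - s))"
    by (simp add: d_def m_def)
  then obtain w' where w': "max 0 (mult_exponent A) < ereal w'"
      "ereal w' < ereal (real d * (real m + s) / (real d + 1 - s))"
    using ereal_dense2 by blast
  then have w'0: "0 < w'" and w'A: "mult_exponent A < ereal w'" by auto
  obtain \<eta> \<epsilon> where \<eta>\<epsilon>: "0 < \<eta>" "0 < \<epsilon>" "\<eta> * (w' * (1 + \<epsilon>)) \<le> real d" "real d + 1 - s < \<eta> * (real m + s)"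
    using exists_exponents[of w' "real d" s "real m"] w' w'0 s dm by (auto simp: d_def)
  obtain K where K: "0 \<le> K"
    "\<And>(q :: nat) \<rho> \<alpha>. 1 \<le> q \<Longrightarrow> real q powr (- \<eta>) \<le> \<rho> \<Longrightarrow>
      real (card {a \<in> (\<Pi>\<^sub>E u\<in>UNIV. {- int (q * (R + 1))..int (q * (R + 1))}).
         \<forall>v. dist_int (\<alpha> v + (\<Sum>u\<in>UNIV. of_int (a u) * A $ u $ v)) \<le> graph_const A * \<rho>})
      \<le> K * \<rho> ^ m * real q ^ d"
    using card_near_graph_le[OF w'A less_imp_le[OF w'0] \<eta>\<epsilon>(2,1) \<eta>\<epsilon>(3)[unfolded d_def]
        graph_const_ge_1[of A], where R = R, folded d_def m_def] by blast
  \<comment> \<open>The cap at 1 makes the covering sets shrink as \<open>q\<close> grows. It loses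
    no points, since the distance to the nearest integer is at most 1/2.\<close>
  define \<rho> where "\<rho> q = max (min (\<psi> q) 1) (real q powr (- \<eta>))" for q
  define G where "G q = {a \<in> (\<Pi>\<^sub>E u\<in>UNIV. {- int (q * (R + 1))..int (q * (R + 1))}).
         \<forall>v. dist_int (real q * \<alpha> $ v + (\<Sum>u\<in>UNIV. of_int (a u) * A $ u $ v)) \<le> graph_const A * \<rho> q}" for q
  \<comment> \<open>The bound on the number of covering sets times the \<open>s\<close>-th power of
    the bound on their diameters.\<close>
  define c where "c q = K * \<rho> q ^ m * real q ^ d * (L * \<rho> q / real q) powr s" for q
  have finG: "finite (G q)" for q 
    unfolding G_def
    by (rule finite_subset[of _ "\<Pi>\<^sub>E u\<in>UNIV. {- int (q * (R + 1))..int (q * (R + 1))}"])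
      (auto intro!: finite_PiE)
  have \<rho>pos: "0 < \<rho> q" if "1 \<le> q" for q using that by (auto simp: \<rho>_def less_max_iff_disj)
  have \<rho>0: "0 \<le> \<rho> q" for q by (simp add: \<rho>_def le_max_iff_disj)
  show ?thesis
  proof (rule hausdorff_cantelli[where F = "\<lambda>q. graph_nbhd \<alpha> A q (\<rho> q) (G q)" and c = c])
    show "0 \<le> c q" for q using K(1) \<rho>0[of q] by (simp add: c_def)
  next
    fix z assume "z \<in> {graph_point \<alpha> A x | x. (\<forall>u. \<bar>x $ u\<bar> \<le> real R) \<and> graph_point \<alpha> A x \<in> simul_approx \<psi>}"
    then obtain x where x: "z = graph_point \<alpha> A x" "\<And>u. \<bar>x $ u\<bar> \<le> real R"
      and inf: "infinite {q. 1 \<le> q \<and> dist_int_vec (real q *\<^sub>R z) < \<psi> q}"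
      by (auto simp: simul_approx_def)
    have "{q. 1 \<le> q \<and> dist_int_vec (real q *\<^sub>R z) < \<psi> q} \<subseteq> {q. z \<in> graph_nbhd \<alpha> A q (\<rho> q) (G q)}"
    proof safe
      fix q :: nat assume q: "1 \<le> q" and lt: "dist_int_vec (real q *\<^sub>R z) < \<psi> q"
      have near: "dist_int (real q * z $ i) \<le> \<rho> q" for i
      proof -
        have "dist_int (real q * z $ i) < \<psi> q"
          using dist_int_le_dist_int_vec[of "real q *\<^sub>R z" i] lt by simp
        then show ?thesis using dist_int_le_half[of "real q * z $ i"] by (auto simp: \<rho>_def)
      qed
      define a where "a u = round (real q * x $ u)" for u
      have err: "\<bar>real q * x $ u - of_int (a u)\<bar> \<le> \<rho> q" for u
        using near[of "Inl u"] by (simp add: x(1) dist_int_eq_round a_def)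
      have "dist_int (real q * \<alpha> $ v + (\<Sum>u\<in>UNIV. of_int (a u) * A $ u $ v)) \<le> graph_const A * \<rho> q" for v
      proof -
        \<comment> \<open>Replacing \<open>q x\<close> by \<open>a\<close> changes the affine form
          by a linear combination of the rounding errors. With the distance of \<open>q z\<close>
          itself this gives \<open>graph_const A * \<rho> q\<close> in total.\<close>
        have "(real q * \<alpha> $ v + (\<Sum>u\<in>UNIV. of_int (a u) * A $ u $ v)) - real q * z $ Inr v
            = - (\<Sum>u\<in>UNIV. (real q * x $ u - of_int (a u)) * A $ u $ v)"
          by (simp add: x(1) distrib_left sum_distrib_left left_diff_distrib sum_subtractf mult.assoc)
        then have "\<bar>(real q * \<alpha> $ v + (\<Sum>u\<in>UNIV. of_int (a u) * A $ u $ v)) - real q * z $ Inr v\<bar>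
            \<le> (graph_const A - 1) * \<rho> q"
          using abs_linear_combination_le[of "\<lambda>u. real q * x $ u - of_int (a u)", OF err, of A v]
          by (metis abs_minus_cancel)
        then have "dist_int (real q * \<alpha> $ v + (\<Sum>u\<in>UNIV. of_int (a u) * A $ u $ v))
            \<le> \<rho> q + (graph_const A - 1) * \<rho> q"
          using dist_int_le_add[of "real q * \<alpha> $ v + (\<Sum>u\<in>UNIV. of_int (a u) * A $ u $ v)" "real q * z $ Inr v"]
            near[of "Inr v"] by linarith
        then show ?thesis by (simp add: left_diff_distrib)
      qed
      moreover have "a \<in> (\<Pi>\<^sub>E u\<in>UNIV. {- int (q * (R + 1))..int (q * (R + 1))})"
        unfolding a_def using round_mem_box[OF x(2), of q] by auto
      ultimately have "a \<in> G q" by (simp add: G_def)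
      then show "z \<in> graph_nbhd \<alpha> A q (\<rho> q) (G q)"
        unfolding graph_nbhd_def x(1) using err by blast
    qed
    then show "infinite {q. z \<in> graph_nbhd \<alpha> A q (\<rho> q) (G q)}"
      using inf finite_subset by blast
  next
    fix \<delta> :: real assume \<delta>: "0 < \<delta>"
    show "\<forall>\<^sub>F q in sequentially.
        hausdorff_premeasure s \<delta> (graph_nbhd \<alpha> A q (\<rho> q) (G q)) \<le> ennreal (c q)"
      using eventually_ge_at_top[of 1] eventually_ge_at_top[of "nat \<lceil>L / \<delta>\<rceil>"]
    proof eventually_elim
      case (elim q)
      have "real q powr (- \<eta>) \<le> 1"
        using elim(1) \<eta>\<epsilon>(1) by (simp add: powr_minus field_simps ge_one_powr_ge_zero)
      then have "\<rho> q \<le> 1" by (simp add: \<rho>_def)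
      then have "L * \<rho> q / real q \<le> L * 1 / real q" using L by (intro divide_right_mono mult_left_mono) auto
      also have "\<dots> \<le> \<delta>"
      proof -
        have "L / \<delta> \<le> real q" using elim(2) by linarith
        then show ?thesis using \<delta> elim(1) by (simp add: field_simps)
      qed
      finally have "hausdorff_premeasure s \<delta> (graph_nbhd \<alpha> A q (\<rho> q) (G q))
          \<le> ennreal (real (card (G q)) * (L * \<rho> q / real q) powr s)"
        unfolding L_def using elim(1) s finG \<rho>0
        by (intro hausdorff_premeasure_graph_nbhd_le) auto
      also have "real (card (G q)) \<le> K * \<rho> q ^ m * real q ^ d"
        unfolding G_def using elim(1) by (intro K(2)) (auto simp: \<rho>_def)
      then have "ennreal (real (card (G q)) * (L * \<rho> q / real q) powr s) \<le> ennreal (c q)"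
        unfolding c_def by (intro ennreal_leI mult_right_mono) auto
      finally show ?case .
    qed
  next
    \<comment> \<open>A maximum is at most a sum: the first series converges by hypothesis, the
      second because its exponent is below -1 by the choice of \<open>\<eta>\<close>.\<close>
    define b where "b q = \<psi> q powr (real m + s) * real q powr (real d - s)
        + real q powr (real d - s - \<eta> * (real m + s))" for q
    have cb: "c q \<le> K * L powr s * b q" if q: "1 \<le> q" for q
    proof -
      have "c q = K * L powr s * (\<rho> q powr (real m + s) * real q powr (real d - s))"
        using q L \<rho>pos[OF q]
        by (simp add: c_def powr_mult powr_divide powr_add powr_diff powr_realpow)
      also have "\<rho> q powr (real m + s) \<le> \<psi> q powr (real m + s) + real q powr (- \<eta> * (real m + s))"
      proof (cases "\<psi> q \<le> real q powr (- \<eta>)")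
        case True
        then have "\<rho> q = real q powr (- \<eta>)" by (auto simp: \<rho>_def)
        then show ?thesis by (simp add: powr_powr)
      next
        case False
        then have "\<rho> q \<le> max (\<psi> q) (real q powr (- \<eta>))" by (auto simp: \<rho>_def)
        then have "\<rho> q \<le> \<psi> q" using False by simp
        then have "\<rho> q powr (real m + s) \<le> \<psi> q powr (real m + s)"
          using \<rho>0[of q] s by (intro powr_mono2) auto
        then show ?thesis by (smt (verit) powr_ge_zero)
      qed
      then have "K * L powr s * (\<rho> q powr (real m + s) * real q powr (real d - s))
          \<le> K * L powr s * ((\<psi> q powr (real m + s) + real q powr (- \<eta> * (real m + s))) * real q powr (real d - s))"
        using K(1) by (intro mult_left_mono mult_right_mono) auto
      also have "\<dots> = K * L powr s * b q"
        by (simp add: b_def distrib_right flip: powr_add)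
      finally show ?thesis .
    qed
    have "summable (\<lambda>q. K * L powr s * b (Suc q))"
    proof (intro summable_mult)
      have "summable (\<lambda>q. real q powr (real d - s - \<eta> * (real m + s)))"
        using \<eta>\<epsilon>(4) by (simp add: summable_real_powr_iff)
      then have "summable (\<lambda>q. real (Suc q) powr (real d - s - \<eta> * (real m + s)))"
        by (subst summable_Suc_iff)
      with sum show "summable (\<lambda>q. b (Suc q))"
        unfolding b_def d_def m_def by (intro summable_add)
    qed
    then have "summable (\<lambda>q. c (Suc q))"
    proof (rule summable_comparison_test')
      fix q
      have "0 \<le> c (Suc q)" using K(1) \<rho>0[of "Suc q"] by (simp add: c_def)
      then show "norm (c (Suc q)) \<le> K * L powr s * b (Suc q)" using cb[of "Suc q"] by simp
    qed
    then show "summable c" by (subst (asm) summable_Suc_iff)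
  qed
qed

theorem theorem1p2:
  fixes n d :: nat
    and A :: "real ^ 'm ^ 'd"
    and \<alpha>\<^sub>0 :: "real ^ 'm"
    and s :: real
    and \<psi> :: "nat \<Rightarrow> real"
  assumes "1 \<le> d" and "d < n"
    and "CARD('d) = d" and "CARD('m) = n - d"
    and "s > 0"
    and "\<And>q. 1 \<le> q \<Longrightarrow> \<psi> q \<ge> 0"
    and "summable (\<lambda>q. \<psi> (Suc q) powr (real n - real d + s) * real (Suc q) powr (real d - s))"
    and "mult_exponent A < ereal (real d * (real n - real d + s)) / ereal (real d + 1 - s)"
  shows "hausdorff_measure s (simul_approx \<psi> \<inter> affine_graph \<alpha>\<^sub>0 A) = 0"
proof -
  \<comment> \<open>Only boundedly many rational points with given denominator can be counted, so
    the subspace is exhausted by countably many bounded pieces.\<close>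
  define E where "E R = {graph_point \<alpha>\<^sub>0 A x | x. (\<forall>u. \<bar>x $ u\<bar> \<le> real R) \<and> graph_point \<alpha>\<^sub>0 A x \<in> simul_approx \<psi>}"
    for R :: nat
  have m: "real CARD('m) = real n - real d" using assms(2,4) by simp
  have "hausdorff_measure s (E R) = 0" for R
  proof (cases "s \<le> real d")
    case True
    \<comment> \<open>Here \<open>d + 1 - s\<close> is at least 1, so the quotient of extended reals
      is the real quotient.\<close>
    have "mult_exponent A < ereal (real d * (real CARD('m) + s) / (real d + 1 - s))"
      using assms(8) True unfolding m by (simp add: ereal_divide)
    then show ?thesis
      unfolding E_def using assms(3,5-7) True
      by (intro hausdorff_measure_simul_approx_graph_eq_0) (auto simp: m)
  next
    case False
    have "E R \<subseteq> {graph_point \<alpha>\<^sub>0 A x | x. \<forall>u. \<bar>x $ u\<bar> \<le> real R}" by (auto simp: E_def)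
    from hausdorff_measure_mono[OF this, of s] show ?thesis
      using hausdorff_measure_bounded_graph_eq_0[where 'd = 'd and 'm = 'm] False assms(3) by simp
  qed
  then have "hausdorff_measure s (\<Union>R. E R) = 0" by (rule hausdorff_measure_UN_eq_0)
  moreover have "simul_approx \<psi> \<inter> affine_graph \<alpha>\<^sub>0 A \<subseteq> (\<Union>R. E R)"
  proof
    fix z assume z: "z \<in> simul_approx \<psi> \<inter> affine_graph \<alpha>\<^sub>0 A"
    then obtain x where x: "z = graph_point \<alpha>\<^sub>0 A x" by (auto simp: affine_graph_def graph_point_def)
    obtain R :: nat where "norm x \<le> real R" using real_arch_simple by blast
    then have "\<forall>u. \<bar>x $ u\<bar> \<le> real R" using component_le_norm_cart order_trans by blast
    then have "z \<in> E R" using z x by (auto simp: E_def)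
    then show "z \<in> (\<Union>R. E R)" by blast
  qed
  ultimately show ?thesis using hausdorff_measure_mono by (metis le_zero_eq)
qed

end
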